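(* The limits of the least square estimators on an increasing sequence of finite dimensional sub-spaces may fail to converge, even when $\beta$ belongs to the limiting space. Precisely: there exist a compact set $T\subset\mathbb{R}$, an $L^2(T)$-valued random element $X$ with $\mathbb{E}[X]=0$ and $\mathbb{E}\|X\|^2<\infty$, a nested sequence $D_1\subset D_2\subset\cdots$ of identifiable sub-spaces of $L^2(T)$ with $\dim D_d=d$, and an element $\beta\in D:=\overline{\bigcup_{d\ge1}D_d}$, such that for each $d\ge1$ the almost sure limit $\lim_{n\to\infty}\widehat\beta^{D_d}_n$ exists in $L^2(T)$, but the sequence $\left\{\lim_{n\to\infty}\widehat\beta^{D_d}_n;\,d\ge1\right\}$ does not converge in $L^2(T)$ as $d\to\infty$.
   Context: $\langle a,b\rangle=\int_T a(t)b(t)\,dt$ is the inner product of $L^2(T)$ and $\|\cdot\|$ its norm. The model is $y_i=\langle x_i,\beta\rangle+\epsilon_i$, where $\beta\in L^2(T)$ is deterministic, $x_1,x_2,\dots$ are i.i.d. copies of $X$, and $\epsilon_1,\epsilon_2,\dots$ are mutually independent real random variables, independent of the $x_i$, with $\mathbb{E}[\epsilon_i]=0$ and $\mathrm{Var}[\epsilon_i]=\sigma^2>0$. $S$ is the smallest closed linear sub-space of $L^2(T)$ containing the support of the law of $X$; a sub-space $D_d$ is identifiable if $D_d\cap S^\perp=\{0\}$. For a finite dimensional identifiable sub-space $D_d$, $\widehat\beta^{D_d}_n=\arg\min_{b\in D_d}\sum_{i=1}^n(y_i-\langle x_i,b\rangle)^2$, which is almost surely uniquely defined for all sufficiently large $n$.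 *)

theory Defs
  imports "HOL-Probability.Probability"
begin

section \<open>The real Hilbert space of square integrable functions on the line\<close>

definition sq_int :: "(real \<Rightarrow> real) \<Rightarrow> bool" where
  "sq_int f \<longleftrightarrow> f \<in> borel_measurable lborel \<and> integrable lborel (\<lambda>t. (f t)\<^sup>2)"

lemma sq_int_measurable: "sq_int f \<Longrightarrow> f \<in> borel_measurable lborel"
  and sq_int_square: "sq_int f \<Longrightarrow> integrable lborel (\<lambda>t. (f t)\<^sup>2)"
  by (auto simp: sq_int_def)

lemma sq_int_bound:
  assumes "f \<in> borel_measurable lborel" "integrable lborel w" "AE t in lborel. (f t)\<^sup>2 \<le> w t"
  shows "sq_int f"
  unfolding sq_int_def
proof
  show "integrable lborel (\<lambda>t. (f t)\<^sup>2)"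
  proof (rule Bochner_Integration.integrable_bound[OF assms(2)])
    show "(\<lambda>t. (f t)\<^sup>2) \<in> borel_measurable lborel" using assms(1) by measurable
    show "AE t in lborel. norm ((f t)\<^sup>2) \<le> norm (w t)" using assms(3) by eventually_elim auto
  qed
qed (fact assms(1))

lemma sq_int_mult_integrable:
  assumes "sq_int f" "sq_int g"
  shows "integrable lborel (\<lambda>t. f t * g t)"
proof (rule Bochner_Integration.integrable_bound)
  show "integrable lborel (\<lambda>t. (f t)\<^sup>2 + (g t)\<^sup>2)"
    using assms by (auto simp: sq_int_def)
  show "(\<lambda>t. f t * g t) \<in> borel_measurable lborel"
    using assms[THEN sq_int_measurable] by measurable
  have "\<bar>f t * g t\<bar> \<le> (f t)\<^sup>2 + (g t)\<^sup>2" for t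
  proof -
    have "0 \<le> (\<bar>f t\<bar> - \<bar>g t\<bar>)\<^sup>2" by simp
    also have "\<dots> = (f t)\<^sup>2 + (g t)\<^sup>2 - 2 * \<bar>f t * g t\<bar>"
      by (simp add: power2_diff abs_mult)
    finally show ?thesis by (smt (verit) abs_ge_zero)
  qed
  then show "AE t in lborel. norm (f t * g t) \<le> norm ((f t)\<^sup>2 + (g t)\<^sup>2)"
    by simp
qed

lemma sq_int_zero: "sq_int (\<lambda>t. 0)"
  by (simp add: sq_int_def)

lemma sq_int_add:
  assumes "sq_int f" "sq_int g"
  shows "sq_int (\<lambda>t. f t + g t)"
proof -
  have "integrable lborel (\<lambda>t. (f t)\<^sup>2 + (g t)\<^sup>2 + 2 * (f t * g t))"
    using assms sq_int_mult_integrable[OF assms] by (auto simp: sq_int_def)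
  then have "integrable lborel (\<lambda>t. (f t + g t)\<^sup>2)"
    by (simp add: power2_sum algebra_simps)
  then show ?thesis
    using assms[THEN sq_int_measurable] by (simp add: sq_int_def)
qed

lemma sq_int_cmult:
  assumes "sq_int f"
  shows "sq_int (\<lambda>t. c * f t)"
  using assms by (auto simp: sq_int_def power_mult_distrib)

lemma sq_int_uminus:
  assumes "sq_int f"
  shows "sq_int (\<lambda>t. - f t)"
  using assms by (auto simp: sq_int_def)

lemma sq_int_diff:
  assumes "sq_int f" "sq_int g"
  shows "sq_int (\<lambda>t. f t - g t)"
  using sq_int_add[OF assms(1) sq_int_uminus[OF assms(2)]] by simp

text \<open>Elements are almost everywhere classes of functions on the whole line, so that
  \<open>L\<^sup>2(T)\<close> for variable \<open>T\<close> is the closed subspace \<open>L2_on T\<close> below, extending functions on \<open>T\<close>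
  by zero. Taking Borel rather than Lebesgue measurable representatives loses no class.\<close>

definition L2_eq :: "(real \<Rightarrow> real) \<Rightarrow> (real \<Rightarrow> real) \<Rightarrow> bool" where
  "L2_eq f g \<longleftrightarrow> sq_int f \<and> sq_int g \<and> (AE t in lborel. f t = g t)"

quotient_type L2 = "real \<Rightarrow> real" / partial: L2_eq
proof (rule part_equivpI)
  show "\<exists>f. L2_eq f f" using sq_int_zero by (auto simp: L2_eq_def)
  show "symp L2_eq"
    by (rule sympI) (auto simp: L2_eq_def elim: AE_mp)
  show "transp L2_eq"
  proof (rule transpI)
    fix f g h assume "L2_eq f g" "L2_eq g h"
    moreover from this have "AE t in lborel. f t = g t" "AE t in lborel. g t = h t"
      by (auto simp: L2_eq_def)
    then have "AE t in lborel. f t = h t" by eventually_elim simp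
    ultimately show "L2_eq f h" by (simp add: L2_eq_def)
  qed
qed

instantiation L2 :: real_vector
begin

lift_definition zero_L2 :: L2 is "\<lambda>t. 0"
  by (simp add: L2_eq_def sq_int_zero)

lift_definition plus_L2 :: "L2 \<Rightarrow> L2 \<Rightarrow> L2" is "\<lambda>f g t. f t + g t"
  unfolding L2_eq_def by (auto intro!: sq_int_add elim!: AE_mp)

lift_definition minus_L2 :: "L2 \<Rightarrow> L2 \<Rightarrow> L2" is "\<lambda>f g t. f t - g t"
  unfolding L2_eq_def by (auto intro!: sq_int_diff elim!: AE_mp)

lift_definition uminus_L2 :: "L2 \<Rightarrow> L2" is "\<lambda>f t. - f t"
  unfolding L2_eq_def by (auto intro!: sq_int_uminus elim!: AE_mp)

lift_definition scaleR_L2 :: "real \<Rightarrow> L2 \<Rightarrow> L2" is "\<lambda>c f t. c * f t"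
  unfolding L2_eq_def by (auto intro!: sq_int_cmult elim!: AE_mp)

instance
  by standard
    (transfer; auto simp: L2_eq_def algebra_simps intro!: sq_int_add sq_int_diff sq_int_uminus
      sq_int_cmult sq_int_zero)+

end

instantiation L2 :: real_inner
begin

lift_definition inner_L2 :: "L2 \<Rightarrow> L2 \<Rightarrow> real" is "\<lambda>f g. \<integral>t. f t * g t \<partial>lborel"
proof -
  fix f f' g g' assume "L2_eq f f'" "L2_eq g g'"
  then have "AE t in lborel. f t = f' t" "AE t in lborel. g t = g' t"
    "sq_int f" "sq_int f'" "sq_int g" "sq_int g'"
    by (auto simp: L2_eq_def)
  note H = this
  note [measurable] = H(3-6)[THEN sq_int_measurable]
  have "AE t in lborel. f t * g t = f' t * g' t"
    using H(1,2) by eventually_elim simp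
  then show "(\<integral>t. f t * g t \<partial>lborel) = (\<integral>t. f' t * g' t \<partial>lborel)"
    by (intro integral_cong_AE) auto
qed

definition norm_L2 :: "L2 \<Rightarrow> real" where "norm_L2 f = sqrt (inner f f)"
definition dist_L2 :: "L2 \<Rightarrow> L2 \<Rightarrow> real" where "dist_L2 f g = norm (f - g)"
definition sgn_L2 :: "L2 \<Rightarrow> L2" where "sgn_L2 f = inverse (norm f) *\<^sub>R f"
definition uniformity_L2 :: "(L2 \<times> L2) filter" where
  "uniformity_L2 = (INF e\<in>{0<..}. principal {(f, g). dist f g < e})"
definition open_L2 :: "L2 set \<Rightarrow> bool" where
  "open_L2 U \<longleftrightarrow> (\<forall>f\<in>U. eventually (\<lambda>(f', g). f' = f \<longrightarrow> g \<in> U) uniformity)"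

instance
proof
  fix f g h :: L2 and c :: real
  show "inner f g = inner g f" by transfer (simp add: mult.commute)
  show "inner (f + g) h = inner f h + inner g h"
    by transfer (simp add: L2_eq_def distrib_right sq_int_mult_integrable)
  show "inner (c *\<^sub>R f) g = c * inner f g"
    by transfer (simp add: mult.assoc)
  show "0 \<le> inner f f"
    by transfer (simp add: integral_nonneg_AE)
  show "inner f f = 0 \<longleftrightarrow> f = 0"
  proof transfer
    fix f assume "L2_eq f f"
    then have f: "sq_int f" by (simp add: L2_eq_def)
    have "(\<integral>t. f t * f t \<partial>lborel) = 0 \<longleftrightarrow> (AE t in lborel. f t * f t = 0)"
      using f sq_int_mult_integrable[OF f f] by (intro integral_nonneg_eq_0_iff_AE) auto
    then show "(\<integral>t. f t * f t \<partial>lborel) = 0 \<longleftrightarrow> L2_eq f (\<lambda>t. 0)"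
      using f sq_int_zero by (simp add: L2_eq_def)
  qed
qed (auto simp: norm_L2_def dist_L2_def sgn_L2_def uniformity_L2_def open_L2_def)

end

lift_definition L2_of :: "(real \<Rightarrow> real) \<Rightarrow> L2" is "\<lambda>f. if sq_int f then f else (\<lambda>t. 0)"
  by (simp add: L2_eq_def sq_int_zero)

lemma L2_of_cases: obtains f where "sq_int f" "F = L2_of f"
proof -
  have "\<exists>f. sq_int f \<and> F = L2_of f"
  proof transfer
    fix F assume "L2_eq F F"
    then show "\<exists>f. sq_int f \<and> L2_eq F (if sq_int f then f else (\<lambda>t. 0))"
      by (intro exI[of _ F]) (simp add: L2_eq_def)
  qed
  then show thesis using that by blast
qed

lemma L2_of_eq_iff:
  assumes "sq_int f" "sq_int g"
  shows "L2_of f = L2_of g \<longleftrightarrow> (AE t in lborel. f t = g t)"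
  using assms by (transfer fixing: f g) (simp add: L2_eq_def)

lemma L2_of_zero: "L2_of (\<lambda>t. 0) = 0"
  by transfer (simp add: L2_eq_def sq_int_zero)

lemma L2_of_add:
  assumes "sq_int f" "sq_int g"
  shows "L2_of (\<lambda>t. f t + g t) = L2_of f + L2_of g"
  using assms by (transfer fixing: f g) (simp add: L2_eq_def sq_int_add)

lemma L2_of_diff:
  assumes "sq_int f" "sq_int g"
  shows "L2_of (\<lambda>t. f t - g t) = L2_of f - L2_of g"
  using assms by (transfer fixing: f g) (simp add: L2_eq_def sq_int_diff)

lemma L2_of_cmult:
  assumes "sq_int f"
  shows "L2_of (\<lambda>t. c * f t) = c *\<^sub>R L2_of f"
  using assms by (transfer fixing: f) (simp add: L2_eq_def sq_int_cmult)

lemma L2_of_sum: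
  assumes "\<And>i. i \<in> I \<Longrightarrow> sq_int (f i)"
  shows "sq_int (\<lambda>t. \<Sum>i\<in>I. f i t)" "L2_of (\<lambda>t. \<Sum>i\<in>I. f i t) = (\<Sum>i\<in>I. L2_of (f i))"
proof -
  have "sq_int (\<lambda>t. \<Sum>i\<in>I. f i t) \<and> L2_of (\<lambda>t. \<Sum>i\<in>I. f i t) = (\<Sum>i\<in>I. L2_of (f i))"
    using assms
    by (induction I rule: infinite_finite_induct)
      (auto simp: sq_int_zero L2_of_zero L2_of_add sq_int_add)
  then show "sq_int (\<lambda>t. \<Sum>i\<in>I. f i t)" "L2_of (\<lambda>t. \<Sum>i\<in>I. f i t) = (\<Sum>i\<in>I. L2_of (f i))"
    by auto
qed

lemma inner_L2_of:
  assumes "sq_int f" "sq_int g"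
  shows "inner (L2_of f) (L2_of g) = (\<integral>t. f t * g t \<partial>lborel)"
  using assms by (transfer fixing: f g) simp

lemma norm_L2_of:
  assumes "sq_int f"
  shows "norm (L2_of f) = sqrt (\<integral>t. (f t)\<^sup>2 \<partial>lborel)"
  using assms by (simp add: norm_eq_sqrt_inner inner_L2_of power2_eq_square)

lemma norm_L2_of_nn:
  assumes "sq_int f"
  shows "ennreal ((norm (L2_of f))\<^sup>2) = (\<integral>\<^sup>+t. ennreal ((f t)\<^sup>2) \<partial>lborel)"
  using assms sq_int_square[OF assms]
  by (subst nn_integral_eq_integral) (auto simp: norm_L2_of integral_nonneg_AE)


subsection \<open>Completeness\<close>

lemma L2_of_tendsto_dominated:
  assumes u: "\<And>n. u n \<in> borel_measurable lborel" and f: "f \<in> borel_measurable lborel"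
    and w: "sq_int w" and bnd: "\<And>n. AE t in lborel. \<bar>u n t\<bar> \<le> w t"
    and lim: "AE t in lborel. (\<lambda>n. u n t) \<longlonglongrightarrow> f t"
  shows "sq_int f" "\<And>n. sq_int (u n)" "(\<lambda>n. L2_of (u n)) \<longlonglongrightarrow> L2_of f"
proof -
  note [measurable] = u f sq_int_measurable[OF w]
  show un: "sq_int (u n)" for n
    by (rule sq_int_bound[OF u sq_int_square[OF w]])
      (use bnd[of n] in \<open>eventually_elim; metis abs_le_square_iff abs_of_nonneg abs_ge_zero order_trans\<close>)
  have all: "AE t in lborel. \<forall>n. \<bar>u n t\<bar> \<le> w t"
    using bnd by (simp add: AE_all_countable)
  have fw: "AE t in lborel. \<bar>f t\<bar> \<le> w t"
    using all lim
  proof eventually_elim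
    case (elim t)
    show ?case by (rule LIMSEQ_le_const2[OF tendsto_rabs[OF elim(2)]]) (use elim(1) in auto)
  qed
  show sf: "sq_int f"
    by (rule sq_int_bound[OF f sq_int_square[OF w]])
      (use fw in \<open>eventually_elim; metis abs_le_square_iff abs_of_nonneg abs_ge_zero order_trans\<close>)
  have "(\<lambda>n. \<integral>t. (u n t - f t)\<^sup>2 \<partial>lborel) \<longlonglongrightarrow> (\<integral>t. 0 \<partial>(lborel::real measure))"
  proof (rule integral_dominated_convergence)
    show "integrable lborel (\<lambda>t. 4 * (w t)\<^sup>2)" using sq_int_square[OF w] by simp
    show "AE t in lborel. (\<lambda>n. (u n t - f t)\<^sup>2) \<longlonglongrightarrow> 0"
      using lim
    proof eventually_elim
      case (elim t)
      have "(\<lambda>n. (u n t - f t)\<^sup>2) \<longlonglongrightarrow> (f t - f t)\<^sup>2" by (intro tendsto_intros elim)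
      then show ?case by simp
    qed
    show "AE t in lborel. norm ((u n t - f t)\<^sup>2) \<le> 4 * (w t)\<^sup>2" for n
      using bnd[of n] fw
    proof eventually_elim
      case (elim t)
      then have "\<bar>u n t - f t\<bar> \<le> \<bar>2 * w t\<bar>" by linarith
      then have "(u n t - f t)\<^sup>2 \<le> (2 * w t)\<^sup>2" by (simp add: abs_le_square_iff)
      then show ?case by (simp add: power_mult_distrib)
    qed
  qed measurable
  then have "(\<lambda>n. sqrt (\<integral>t. (u n t - f t)\<^sup>2 \<partial>lborel)) \<longlonglongrightarrow> sqrt 0"
    by (intro tendsto_real_sqrt) simp
  then have "(\<lambda>n. norm (L2_of (u n) - L2_of f)) \<longlonglongrightarrow> 0"
    by (simp add: norm_L2_of L2_of_diff[symmetric] un sf sq_int_diff)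
  then show "(\<lambda>n. L2_of (u n)) \<longlonglongrightarrow> L2_of f"
    by (simp add: tendsto_norm_zero_iff LIM_zero_iff)
qed

lemma L2_fast_Cauchy_convergent:
  fixes F :: "nat \<Rightarrow> L2"
  assumes fast: "\<And>k. dist (F (Suc k)) (F k) \<le> (1/2)^k" and "Cauchy F"
  shows "convergent F"
proof -
  have "\<exists>u. \<forall>k. sq_int (u k) \<and> F k = L2_of (u k)"
    by (rule choice) (metis L2_of_cases)
  then obtain u where u: "\<And>k. sq_int (u k)" and F: "\<And>k. F k = L2_of (u k)" by blast
  note [measurable] = u[THEN sq_int_measurable]
  define d where "d k t = u (Suc k) t - u k t" for k t
  have dm [measurable]: "d k \<in> borel_measurable lborel" for k unfolding d_def by measurable
  have dsq: "(\<integral>\<^sup>+t. ennreal ((d k t)\<^sup>2) \<partial>lborel) \<le> ennreal ((1/4)^k)" for k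
  proof -
    have "(\<integral>\<^sup>+t. ennreal ((d k t)\<^sup>2) \<partial>lborel) = ennreal ((dist (F (Suc k)) (F k))\<^sup>2)"
      unfolding d_def F dist_norm
      by (simp add: L2_of_diff[symmetric] u norm_L2_of_nn sq_int_diff)
    also have "(dist (F (Suc k)) (F k))\<^sup>2 \<le> ((1/2)^k)\<^sup>2"
      by (intro power_mono fast) auto
    then have "ennreal ((dist (F (Suc k)) (F k))\<^sup>2) \<le> ennreal ((1/4)^k)"
      by (simp add: power2_eq_square power_mult_distrib[symmetric] ennreal_leI)
    finally show ?thesis .
  qed
  define G where "G t = (\<Sum>k. ennreal (2^k * (d k t)\<^sup>2))" for t
  have "(\<integral>\<^sup>+t. G t \<partial>lborel) = (\<Sum>k. \<integral>\<^sup>+t. ennreal (2^k * (d k t)\<^sup>2) \<partial>lborel)"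
    unfolding G_def by (intro nn_integral_suminf) measurable
  also have "\<dots> \<le> (\<Sum>k. ennreal ((1/2)^k))"
  proof (intro suminf_le)
    fix k
    have "(\<integral>\<^sup>+t. ennreal (2^k * (d k t)\<^sup>2) \<partial>lborel) = ennreal (2^k) * (\<integral>\<^sup>+t. ennreal ((d k t)\<^sup>2) \<partial>lborel)"
      by (subst nn_integral_cmult[symmetric]) (auto simp: ennreal_mult)
    also have "\<dots> \<le> ennreal (2^k) * ennreal ((1/4)^k)"
      by (intro mult_left_mono dsq) auto
    also have "\<dots> = ennreal (2^k * (1/4)^k)" by (simp add: ennreal_mult)
    also have "2^k * (1/4)^k = (1/2::real)^k" by (simp add: power_mult_distrib[symmetric])
    finally show "(\<integral>\<^sup>+t. ennreal (2^k * (d k t)\<^sup>2) \<partial>lborel) \<le> ennreal ((1/2)^k)" .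
  qed auto
  also have "\<dots> = ennreal (\<Sum>k. (1/2)^k)"
    by (intro suminf_ennreal2) auto
  finally have "(\<integral>\<^sup>+t. G t \<partial>lborel) \<noteq> \<infinity>" by (auto simp: top_unique)
  then have "AE t in lborel. G t \<noteq> \<infinity>"
    by (intro nn_integral_PInf_AE) (auto simp: G_def)
  then have conv: "AE t in lborel. convergent (\<lambda>m. u m t)"
  proof eventually_elim
    case (elim t)
    then have "summable (\<lambda>k. 2^k * (d k t)\<^sup>2)"
      unfolding G_def by (intro summable_suminf_not_top) auto
    then have S: "summable (\<lambda>k. 2^k * (d k t)\<^sup>2 + (1/2)^k)"
      by (intro summable_add) auto
    have "summable (\<lambda>k. d k t)"
    proof (rule summable_comparison_test'[OF S])
      fix k :: nat
      define c where "c = (2::real)^k"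
      have c: "c > 0" by (simp add: c_def)
      have "0 \<le> (c * \<bar>d k t\<bar> - 1)\<^sup>2" by simp
      then have "2 * (c * \<bar>d k t\<bar>) \<le> c\<^sup>2 * (d k t)\<^sup>2 + 1"
        by (simp add: power2_diff power_mult_distrib)
      moreover have "0 \<le> c\<^sup>2 * (d k t)\<^sup>2 + 1" by simp
      ultimately have "c * \<bar>d k t\<bar> \<le> c\<^sup>2 * (d k t)\<^sup>2 + 1" by linarith
      also have "\<dots> = c * (c * (d k t)\<^sup>2 + 1 / c)"
        using c by (simp add: algebra_simps power2_eq_square)
      finally have "\<bar>d k t\<bar> \<le> c * (d k t)\<^sup>2 + 1 / c" using c by (simp only: mult_le_cancel_left_pos)
      then show "norm (d k t) \<le> 2^k * (d k t)\<^sup>2 + (1/2)^k"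
        by (simp add: c_def power_one_over)
    qed
    then have "convergent (\<lambda>m. \<Sum>k<m. d k t)" by (simp add: summable_iff_convergent)
    then have "convergent (\<lambda>m. (\<Sum>k<m. d k t) + u 0 t)" by (intro convergent_add convergent_const)
    moreover have "(\<Sum>k<m. d k t) + u 0 t = u m t" for m
      unfolding d_def using sum_lessThan_telescope[of "\<lambda>k. u k t" m] by simp
    ultimately show ?case by simp
  qed
  define f where "f t = lim (\<lambda>m. u m t)" for t
  have fm [measurable]: "f \<in> borel_measurable lborel"
    unfolding f_def by measurable
  have lim: "AE t in lborel. (\<lambda>m. u m t) \<longlonglongrightarrow> f t"
    using conv by eventually_elim (simp add: f_def convergent_LIMSEQ_iff)
  have key: "(\<integral>\<^sup>+t. ennreal ((f t - u k t)\<^sup>2) \<partial>lborel) \<le> ennreal (e\<^sup>2)"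
    if e: "\<And>m. m \<ge> k \<Longrightarrow> dist (F m) (F k) \<le> e" for k e
  proof -
    have "(\<integral>\<^sup>+t. ennreal ((f t - u k t)\<^sup>2) \<partial>lborel)
        = (\<integral>\<^sup>+t. liminf (\<lambda>m. ennreal ((u m t - u k t)\<^sup>2)) \<partial>lborel)"
    proof (rule nn_integral_cong_AE, use lim in eventually_elim)
      case (elim t)
      have "(\<lambda>m. ennreal ((u m t - u k t)\<^sup>2)) \<longlonglongrightarrow> ennreal ((f t - u k t)\<^sup>2)"
        by (intro tendsto_ennrealI tendsto_intros elim)
      then show ?case by (rule lim_imp_Liminf[OF trivial_limit_sequentially, symmetric])
    qed
    also have "\<dots> \<le> liminf (\<lambda>m. \<integral>\<^sup>+t. ennreal ((u m t - u k t)\<^sup>2) \<partial>lborel)"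
      by (intro nn_integral_liminf) measurable
    also have "\<dots> \<le> liminf (\<lambda>m. ennreal (e\<^sup>2))"
    proof (intro Liminf_mono, use eventually_ge_at_top[of k] in eventually_elim)
      case (elim m)
      have "(\<integral>\<^sup>+t. ennreal ((u m t - u k t)\<^sup>2) \<partial>lborel) = ennreal ((dist (F m) (F k))\<^sup>2)"
        by (simp add: F dist_norm L2_of_diff[symmetric] u norm_L2_of_nn sq_int_diff)
      also have "\<dots> \<le> ennreal (e\<^sup>2)"
        by (intro ennreal_leI power_mono e elim) auto
      finally show ?case .
    qed
    also have "\<dots> = ennreal (e\<^sup>2)" by (simp add: Liminf_const)
    finally show ?thesis .
  qed
  have sqd: "sq_int (\<lambda>t. f t - u k t)" if e: "\<And>m. m \<ge> k \<Longrightarrow> dist (F m) (F k) \<le> e" for k e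
    unfolding sq_int_def
    using key[OF e] by (auto intro!: integrableI_bounded simp: less_top[symmetric] top_unique)
  obtain K where K: "\<And>m. m \<ge> K \<Longrightarrow> dist (F m) (F K) \<le> 1"
    using \<open>Cauchy F\<close> unfolding Cauchy_def by (metis less_imp_le order_refl zero_less_one)
  have sf: "sq_int f"
    using sq_int_add[OF sqd[OF K] u[of K]] by simp
  have "F \<longlonglongrightarrow> L2_of f"
  proof (rule metric_LIMSEQ_I)
    fix e :: real assume "e > 0"
    then obtain N where N: "\<And>m k. m \<ge> N \<Longrightarrow> k \<ge> N \<Longrightarrow> dist (F m) (F k) < e / 2"
      using \<open>Cauchy F\<close> unfolding Cauchy_def by (meson half_gt_zero)
    have "dist (F k) (L2_of f) < e" if k: "k \<ge> N" for k
    proof -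
      have "ennreal ((dist (L2_of f) (F k))\<^sup>2) \<le> ennreal ((e/2)\<^sup>2)"
        using key[of k "e/2"] N k
        by (simp add: F dist_norm L2_of_diff[symmetric] u sf norm_L2_of_nn sq_int_diff less_imp_le)
      then have "(dist (L2_of f) (F k))\<^sup>2 \<le> (e/2)\<^sup>2" by simp
      then have "dist (L2_of f) (F k) \<le> e / 2"
        by (rule power2_le_imp_le) (use \<open>e > 0\<close> in auto)
      then show ?thesis using \<open>e > 0\<close> by (simp add: dist_commute)
    qed
    then show "\<exists>N. \<forall>k\<ge>N. dist (F k) (L2_of f) < e" by blast
  qed
  then show ?thesis by (auto simp: convergent_def)
qed

instance L2 :: banach
proof
  fix F :: "nat \<Rightarrow> L2" assume C: "Cauchy F"
  have "\<exists>N. \<forall>m\<ge>N. \<forall>n\<ge>N. dist (F m) (F n) < (1/2)^k" for k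
    using C unfolding Cauchy_def by (meson zero_less_power half_gt_zero zero_less_one)
  then obtain N where N: "\<And>k m n. m \<ge> N k \<Longrightarrow> n \<ge> N k \<Longrightarrow> dist (F m) (F n) < (1/2)^k"
    by metis
  define r where "r = rec_nat (N 0) (\<lambda>k a. max (N (Suc k)) (Suc a))"
  have r: "r (Suc k) = max (N (Suc k)) (Suc (r k))" "r 0 = N 0" for k by (auto simp: r_def)
  have mono: "strict_mono r" by (intro strict_mono_Suc_iff[THEN iffD2]) (auto simp: r)
  have rN: "r k \<ge> N k" for k by (cases k) (auto simp: r)
  have "convergent (F \<circ> r)"
  proof (rule L2_fast_Cauchy_convergent)
    show "Cauchy (F \<circ> r)" using C mono by (rule Cauchy_subseq_Cauchy)
    show "dist ((F \<circ> r) (Suc k)) ((F \<circ> r) k) \<le> (1/2)^k" for k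
      using N[of k "r (Suc k)" "r k"] rN[of k] strict_monoD[OF mono, of k "Suc k"] by simp
  qed
  then obtain L where "(F \<circ> r) \<longlonglongrightarrow> L" by (auto simp: convergent_def)
  then show "convergent F"
    using Cauchy_converges_subseq[OF C mono] unfolding o_def convergent_def by blast
qed


subsection \<open>Separability\<close>

lemma subspace_closure:
  fixes V :: "'a::real_normed_vector set"
  assumes "subspace V"
  shows "subspace (closure V)"
  unfolding subspace_def
proof (intro conjI ballI allI)
  show "0 \<in> closure V" using assms closure_subset subspace_0 by blast
  show "x + y \<in> closure V" if xy: "x \<in> closure V" "y \<in> closure V" for x y
  proof -
    obtain a b where "\<And>n. a n \<in> V" "a \<longlonglongrightarrow> x" "\<And>n. b n \<in> V" "b \<longlonglongrightarrow> y"
      using xy unfolding closure_sequential by blast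
    then show ?thesis unfolding closure_sequential
      by (intro exI[of _ "\<lambda>n. a n + b n"]) (auto intro!: subspace_add[OF assms] tendsto_intros)
  qed
  show "c *\<^sub>R x \<in> closure V" if x: "x \<in> closure V" for c x
  proof -
    obtain a where "\<And>n. a n \<in> V" "a \<longlonglongrightarrow> x"
      using x unfolding closure_sequential by blast
    then show ?thesis unfolding closure_sequential
      by (intro exI[of _ "\<lambda>n. c *\<^sub>R a n"]) (auto intro!: subspace_scale[OF assms] tendsto_intros)
  qed
qed

lemma second_countable_of_countable_span:
  fixes C :: "'a::real_normed_vector set"
  assumes "countable C" and dense: "closure (span C) = UNIV"
  shows "\<exists>B::'a set set. countable B \<and> open = generate_topology B"
proof -
  define comb :: "(rat \<times> 'a) list \<Rightarrow> 'a" where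
    "comb l = sum_list (map (\<lambda>(q, c). of_rat q *\<^sub>R c) l)" for l
  define W where "W = comb ` lists (UNIV \<times> C)"
  have cW: "countable W"
    unfolding W_def using \<open>countable C\<close> by (intro countable_image countable_lists) auto
  have W0: "0 \<in> W"
    unfolding W_def by (rule image_eqI[of _ _ "[]"]) (auto simp: comb_def)
  have Wadd: "x + y \<in> W" if "x \<in> W" "y \<in> W" for x y
  proof -
    obtain l m where "l \<in> lists (UNIV \<times> C)" "m \<in> lists (UNIV \<times> C)" "x = comb l" "y = comb m"
      using \<open>x \<in> W\<close> \<open>y \<in> W\<close> unfolding W_def by blast
    then show ?thesis
      unfolding W_def by (intro image_eqI[of _ _ "l @ m"]) (auto simp: comb_def)
  qed
  have Wscale: "of_rat q *\<^sub>R x \<in> W" if x: "x \<in> W" for q x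
  proof -
    obtain l where l: "l \<in> lists (UNIV \<times> C)" "x = comb l" using x unfolding W_def by blast
    have "of_rat q *\<^sub>R comb l = comb (map (\<lambda>(p, c). (q * p, c)) l)"
      by (induction l) (auto simp: comb_def scaleR_add_right of_rat_mult)
    moreover have "map (\<lambda>(p, c). (q * p, c)) l \<in> lists (UNIV \<times> C)"
      using l(1) by (induction l) auto
    ultimately show ?thesis unfolding W_def l(2) by (metis imageI)
  qed
  have add: "x + y \<in> closure W" if xy: "x \<in> closure W" "y \<in> closure W" for x y
  proof -
    obtain a b where "\<And>n. a n \<in> W" "a \<longlonglongrightarrow> x" "\<And>n. b n \<in> W" "b \<longlonglongrightarrow> y"
      using xy unfolding closure_sequential by blast
    then show ?thesis unfolding closure_sequential
      by (intro exI[of _ "\<lambda>n. a n + b n"]) (auto intro!: Wadd tendsto_intros)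
  qed
  have scale: "c *\<^sub>R x \<in> closure W" if x: "x \<in> closure W" for c x
  proof -
    obtain a where a: "\<And>n. a n \<in> W" "a \<longlonglongrightarrow> x"
      using x unfolding closure_sequential by blast
    have "\<exists>q::rat. \<bar>of_rat q - c\<bar> < 1 / real (Suc n)" for n
    proof -
      obtain q :: rat where "c < of_rat q" "of_rat q < c + 1 / real (Suc n)"
        using of_rat_dense[of c "c + 1 / real (Suc n)"] by auto
      then show ?thesis by (intro exI[of _ q]) auto
    qed
    then obtain q :: "nat \<Rightarrow> rat" where q: "\<And>n. \<bar>of_rat (q n) - c\<bar> < 1 / real (Suc n)" by metis
    have "(\<lambda>n. of_rat (q n) - c) \<longlonglongrightarrow> 0"
      by (rule Lim_null_comparison[OF _ LIMSEQ_inverse_real_of_nat])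
        (use q in \<open>auto intro!: always_eventually less_imp_le simp: inverse_eq_divide\<close>)
    then have "(\<lambda>n. of_rat (q n)) \<longlonglongrightarrow> c" by (simp add: LIM_zero_iff)
    then show ?thesis unfolding closure_sequential using a
      by (intro exI[of _ "\<lambda>n. of_rat (q n) *\<^sub>R a n"]) (auto intro!: Wscale tendsto_intros)
  qed
  have "0 \<in> closure W" using W0 closure_subset by blast
  then have "subspace (closure W)" using add scale by (auto simp: subspace_def)
  moreover have "C \<subseteq> closure W"
  proof
    fix c assume "c \<in> C"
    then have "c \<in> W" unfolding W_def by (intro image_eqI[of _ _ "[(1, c)]"]) (auto simp: comb_def)
    then show "c \<in> closure W" using closure_subset by blast
  qed
  ultimately have "span C \<subseteq> closure W" by (rule span_minimal[rotated])
  then have dW: "closure W = UNIV" using dense by (metis closure_closure closure_mono top.extremum_uniqueI)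
  define B where "B = (\<lambda>(x, n). ball x (1 / real (Suc n))) ` (W \<times> (UNIV :: nat set))"
  have "topological_basis B"
  proof (rule topological_basisI)
    show "open U" if "U \<in> B" for U using that by (auto simp: B_def)
    fix U and x :: 'a assume "open U" "x \<in> U"
    then obtain e where e: "e > 0" "ball x e \<subseteq> U" by (auto simp: open_contains_ball)
    obtain n where n: "1 / real (Suc n) < e / 2"
      using e(1) nat_approx_posE[of "e/2"] by (metis half_gt_zero)
    have "x \<in> closure W" using dW by simp
    then obtain w where w: "w \<in> W" "dist w x < 1 / real (Suc n)"
      unfolding closure_approachable by (meson of_nat_0_less_iff zero_less_Suc zero_less_divide_1_iff)
    have "ball w (1 / real (Suc n)) \<subseteq> ball x e"
    proof
      fix y assume "y \<in> ball w (1 / real (Suc n))"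
      then have "dist w y < e / 2" using n by simp
      moreover have "dist x w < e / 2" using w n by (simp add: dist_commute)
      ultimately show "y \<in> ball x e" using dist_triangle[of x y w] by simp
    qed
    moreover have "ball w (1 / real (Suc n)) \<in> B" using w(1) by (auto simp: B_def)
    moreover have "x \<in> ball w (1 / real (Suc n))" using w(2) by simp
    ultimately show "\<exists>V\<in>B. x \<in> V \<and> V \<subseteq> U" using e(2) by blast
  qed
  moreover have "countable B" unfolding B_def using cW by (intro countable_image) auto
  ultimately show ?thesis by (intro exI[of _ B]) (auto simp: topological_basis_imp_subbasis)
qed

lemma L2_closed_subspace_eq_UNIV:
  assumes V: "subspace V" "closed V"
    and Ioc: "\<And>a b. L2_of (indicator {a<..b}) \<in> V"
  shows "V = (UNIV :: L2 set)"
proof -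
  have bounded: "sq_int (indicator (A \<inter> {a<..b}))" if [measurable]: "A \<in> sets borel" for A and a b :: real
  proof (rule sq_int_bound)
    show "integrable lborel (indicator {a<..b} :: real \<Rightarrow> real)"
      by (cases "a \<le> b") auto
  qed (auto simp: indicator_def)
  have basic: "L2_of (indicator (A \<inter> {a<..b})) \<in> V" if A: "A \<in> sets borel" for A and a b :: real
  proof -
    have As: "A \<in> sigma_sets UNIV (range (\<lambda>(a, b). {a<..b::real}))"
      using A by (simp add: borel_sigma_sets_Ioc)
    have "Int_stable (range (\<lambda>(a, b). {a<..b::real}))"
      proof (rule Int_stableI)
      fix A B assume "A \<in> range (\<lambda>(a, b). {a<..b::real})" "B \<in> range (\<lambda>(a, b). {a<..b::real})"
      then obtain a b a' b' where "A = {a<..b}" "B = {a'<..b'}" by auto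
      then show "A \<inter> B \<in> range (\<lambda>(a, b). {a<..b::real})"
        by (intro image_eqI[of _ _ "(max a a', min b b')"]) (auto simp: Int_greaterThanAtMost)
    qed
    moreover have "range (\<lambda>(a, b). {a<..b::real}) \<subseteq> Pow UNIV" by simp
    ultimately show ?thesis using As
    proof (induction A rule: sigma_sets_induct_disjoint)
      case (basic A)
      then show ?case using Ioc by (auto simp: Int_greaterThanAtMost)
    next
      case empty
      have "(indicator {} :: real \<Rightarrow> real) = (\<lambda>t. 0)" by auto
      then show ?case using V(1) by (simp add: L2_of_zero subspace_0)
    next
      case (compl A)
      have A: "A \<in> sets borel" using compl(1) by (simp add: borel_sigma_sets_Ioc)
      have "(indicator ((UNIV - A) \<inter> {a<..b}) :: real \<Rightarrow> real)
          = (\<lambda>t. indicator (UNIV \<inter> {a<..b}) t - indicator (A \<inter> {a<..b}) t)"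
        by (auto simp: indicator_def)
      then have "L2_of (indicator ((UNIV - A) \<inter> {a<..b}))
          = L2_of (indicator (UNIV \<inter> {a<..b})) - L2_of (indicator (A \<inter> {a<..b}))"
        using L2_of_diff[OF bounded[of UNIV] bounded[OF A]] by simp
      then show ?case using compl(2) Ioc V(1) by (simp add: subspace_diff)
    next
      case (union A)
      have A: "A i \<in> sets borel" for i using union(2) by (auto simp: borel_sigma_sets_Ioc)
      note [measurable] = A
      define u where "u n t = (\<Sum>i<n. indicator (A i \<inter> {a<..b}) t :: real)" for n t
      have u: "u n = indicator ((\<Union>i<n. A i) \<inter> {a<..b})" for n
      proof
        fix t
        have dj: "disjoint_family_on (\<lambda>i. A i \<inter> {a<..b}) {..<n}"
          using union(1) by (auto simp: disjoint_family_on_def)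
        have eq: "(\<Union>i<n. A i) \<inter> {a<..b} = (\<Union>i<n. A i \<inter> {a<..b})" by auto
        show "u n t = indicator ((\<Union>i<n. A i) \<inter> {a<..b}) t"
          unfolding u_def eq by (rule indicator_UN_disjoint[OF finite_lessThan dj, symmetric])
      qed
      have "L2_of (u n) \<in> V" for n
        unfolding u_def using L2_of_sum(2)[of "{..<n}" "\<lambda>i. indicator (A i \<inter> {a<..b})"] bounded[OF A]
        by (simp add: subspace_sum[OF V(1)] union(3))
      moreover have "(\<lambda>n. L2_of (u n)) \<longlonglongrightarrow> L2_of (indicator ((\<Union>i. A i) \<inter> {a<..b}))"
      proof (rule L2_of_tendsto_dominated(3)[OF _ _ bounded[of UNIV a b]])
        show "u n \<in> borel_measurable lborel" for n unfolding u by measurable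
        show "AE t in lborel. \<bar>u n t\<bar> \<le> indicator (UNIV \<inter> {a<..b}) t" for n
          unfolding u by (auto simp: indicator_def)
        have "(\<lambda>n. u n t) \<longlonglongrightarrow> indicator ((\<Union>i. A i) \<inter> {a<..b}) t" for t
        proof (cases "t \<in> (\<Union>i. A i)")
          case True
          then obtain i where "t \<in> A i" by blast
          then have "\<forall>n\<ge>Suc i. u n t = indicator ((\<Union>i. A i) \<inter> {a<..b}) t"
            unfolding u by (auto simp: indicator_def)
          then show ?thesis
            by (intro tendsto_eventually) (auto simp: eventually_sequentially)
        qed (auto simp: u)
        then show "AE t in lborel. (\<lambda>n. u n t) \<longlonglongrightarrow> indicator ((\<Union>i. A i) \<inter> {a<..b}) t" by simp
      qed auto
      ultimately show ?case by (rule closed_sequentially[OF V(2)])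
    qed
  qed
  have ind: "L2_of (indicator A) \<in> V" if A: "A \<in> sets borel" and s: "sq_int (indicator A)" for A
  proof (rule closed_sequentially[OF V(2) basic[OF A]])
    show "(\<lambda>n. L2_of (indicator (A \<inter> {- real n<..real n}))) \<longlonglongrightarrow> L2_of (indicator A)"
    proof (rule L2_of_tendsto_dominated(3)[OF _ _ s])
      have "(\<lambda>n. indicator (A \<inter> {- real n<..real n}) t) \<longlonglongrightarrow> (indicator A t :: real)" for t
      proof -
        obtain N where "real N > \<bar>t\<bar>" using reals_Archimedean2 by blast
        then have "\<forall>n\<ge>N. indicator (A \<inter> {- real n<..real n}) t = (indicator A t :: real)"
          by (auto simp: indicator_def)
        then show ?thesis by (intro tendsto_eventually) (auto simp: eventually_sequentially)
      qed
      then show "AE t in lborel. (\<lambda>n. indicator (A \<inter> {- real n<..real n}) t) \<longlonglongrightarrow> (indicator A t :: real)"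
        by simp
    qed (use A in \<open>auto simp: indicator_def\<close>)
  qed
  have nonneg: "sq_int f \<longrightarrow> L2_of f \<in> V"
    if "f \<in> borel_measurable lborel" "\<And>t. 0 \<le> f t" for f
    using that
  proof (induction f rule: borel_measurable_induct_real)
    case (set A)
    then show ?case using ind by simp
  next
    case (mult u c)
    show ?case
    proof
      assume s: "sq_int (\<lambda>t. c * u t)"
      show "L2_of (\<lambda>t. c * u t) \<in> V"
      proof (cases "c = 0")
        case True
        then show ?thesis using V(1) by (simp add: L2_of_zero subspace_0)
      next
        case False
        then have "sq_int u" using sq_int_cmult[OF s, of "1/c"] by simp
        then show ?thesis using mult(4) V(1) by (simp add: L2_of_cmult subspace_scale)
      qed
    qed
  next
    case (add u v)
    show ?case
    proof
      assume s: "sq_int (\<lambda>t. v t + u t)"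
      have "sq_int u" "sq_int v"
        by (rule sq_int_bound[OF _ sq_int_square[OF s]]; use add in \<open>force intro!: power_mono\<close>)+
      then show "L2_of (\<lambda>t. v t + u t) \<in> V"
        using add V(1) by (simp add: L2_of_add subspace_add)
    qed
  next
    case (seq U)
    show ?case
    proof
      assume s: "sq_int f"
      have le: "U i t \<le> f t" for i t
        using seq.hyps(3,4) by (intro incseq_le) (auto simp: incseq_def le_fun_def)
      have bnd: "AE t in lborel. \<bar>U i t\<bar> \<le> f t" for i
        using seq.hyps(2) le by simp
      have lim: "AE t in lborel. (\<lambda>i. U i t) \<longlonglongrightarrow> f t"
        using seq.hyps(4) by simp
      note T = L2_of_tendsto_dominated[OF seq.hyps(1) sq_int_measurable[OF s] s bnd lim]
      show "L2_of f \<in> V"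
        using seq.IH T(2) by (intro closed_sequentially[OF V(2) _ T(3)]) auto
    qed
  qed
  have "F \<in> V" for F
  proof -
    obtain f where f: "sq_int f" "F = L2_of f" by (rule L2_of_cases)
    note [measurable] = sq_int_measurable[OF f(1)]
    have p: "sq_int (\<lambda>t. max 0 (f t))"
      by (rule sq_int_bound[OF _ sq_int_square[OF f(1)]]) (auto simp: max_def)
    have m: "sq_int (\<lambda>t. max 0 (- f t))"
      by (rule sq_int_bound[OF _ sq_int_square[OF f(1)]]) (auto simp: max_def)
    have "f = (\<lambda>t. max 0 (f t) - max 0 (- f t))" by (auto simp: max_def)
    then have "F = L2_of (\<lambda>t. max 0 (f t)) - L2_of (\<lambda>t. max 0 (- f t))"
      using L2_of_diff[OF p m] f(2) by simp
    then show ?thesis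
      using nonneg[of "\<lambda>t. max 0 (f t)"] nonneg[of "\<lambda>t. max 0 (- f t)"] p m V(1)
      by (simp add: subspace_diff)
  qed
  then show ?thesis by blast
qed

lemma L2_dense_countable_span:
  "closure (span ((\<lambda>(p, q). L2_of (indicator {of_rat p<..of_rat q})) ` (UNIV :: (rat \<times> rat) set))) = UNIV"
proof (rule L2_closed_subspace_eq_UNIV)
  let ?C = "(\<lambda>(p, q). L2_of (indicator {of_rat p<..of_rat q})) ` (UNIV :: (rat \<times> rat) set)"
  show "subspace (closure (span ?C))" by (rule subspace_closure) (rule subspace_span)
  show "closed (closure (span ?C))" by simp
  fix a b :: real
  have app: "\<exists>p::nat \<Rightarrow> rat. (\<forall>n. c < of_rat (p n) \<and> of_rat (p n) < c + 1 / real (Suc n))" for c :: real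
    by (rule choice) (use of_rat_dense[of c] in auto)
  obtain p q :: "nat \<Rightarrow> rat"
    where p: "\<And>n. a < of_rat (p n)" "\<And>n. of_rat (p n) < a + 1 / real (Suc n)"
      and q: "\<And>n. b < of_rat (q n)" "\<And>n. of_rat (q n) < b + 1 / real (Suc n)"
    using app[of a] app[of b] by blast
  have ev: "\<forall>\<^sub>F n in sequentially. 1 / real (Suc n) < d" if "d > 0" for d
  proof -
    have "(\<lambda>n. 1 / real (Suc n)) \<longlonglongrightarrow> 0"
      using LIMSEQ_inverse_real_of_nat by (simp only: inverse_eq_divide)
    then show ?thesis using that by (rule order_tendstoD(2))
  qed
  have mem: "L2_of (indicator {of_rat (p n)<..of_rat (q n)}) \<in> closure (span ?C)" for n
  proof -
    have "L2_of (indicator {of_rat (p n)<..of_rat (q n)}) \<in> ?C"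
      by (rule image_eqI[of _ _ "(p n, q n)"]) auto
    then show ?thesis by (rule subsetD[OF closure_subset span_base])
  qed
  have w: "sq_int (indicator {a<..b + 1})"
  proof (rule sq_int_bound)
    show "integrable lborel (indicator {a<..b + 1} :: real \<Rightarrow> real)"
      by (cases "a \<le> b + 1") auto
  qed (auto simp: indicator_def)
  have "(\<lambda>n. L2_of (indicator {of_rat (p n)<..of_rat (q n)})) \<longlonglongrightarrow> L2_of (indicator {a<..b})"
  proof (rule L2_of_tendsto_dominated(3)[OF _ _ w])
    fix n
    have "1 / real (Suc n) \<le> 1" by simp
    then have "real_of_rat (q n) \<le> b + 1" using q(2)[of n] by linarith
    then show "AE t in lborel. \<bar>indicator {of_rat (p n)<..of_rat (q n)} t\<bar> \<le> (indicator {a<..b + 1} t :: real)"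
      using p(1)[of n] by (auto simp: indicator_def)
  next
    have "(\<lambda>n. indicator {of_rat (p n)<..of_rat (q n)} t) \<longlonglongrightarrow> (indicator {a<..b} t :: real)" for t
    proof -
      have "\<forall>\<^sub>F n in sequentially. of_rat (p n) < t \<longleftrightarrow> a < t"
      proof (cases "a < t")
        case True
        then have "t - a > 0" by simp
        from ev[OF this] show ?thesis
        proof eventually_elim
          case (elim n)
          then show ?case using True p(2)[of n] by linarith
        qed
      next
        case False
        then have "\<not> of_rat (p n) < t" for n using p(1)[of n] by linarith
        then show ?thesis using False by simp
      qed
      moreover have "\<forall>\<^sub>F n in sequentially. t \<le> of_rat (q n) \<longleftrightarrow> t \<le> b"
      proof (cases "t \<le> b")
        case True
        then have "\<forall>n. t \<le> of_rat (q n)" using q(1) by (meson less_imp_le order_trans)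
        then show ?thesis using True by simp
      next
        case False
        then have "t - b > 0" by simp
        from ev[OF this] show ?thesis
        proof eventually_elim
          case (elim n)
          then show ?case using False q(2)[of n] by linarith
        qed
      qed
      ultimately have "\<forall>\<^sub>F n in sequentially. indicator {of_rat (p n)<..of_rat (q n)} t = (indicator {a<..b} t :: real)"
        by eventually_elim (auto simp: indicator_def)
      then show ?thesis by (rule tendsto_eventually)
    qed
    then show "AE t in lborel. (\<lambda>n. indicator {of_rat (p n)<..of_rat (q n)} t) \<longlonglongrightarrow> (indicator {a<..b} t :: real)"
      by simp
  qed auto
  then show "L2_of (indicator {a<..b}) \<in> closure (span ?C)"
    by (rule closed_sequentially[OF closed_closure mem])
qed

instance L2 :: second_countable_topology
  by standard
    (rule second_countable_of_countable_span[OF _ L2_dense_countable_span], simp)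


subsection \<open>The spaces \<open>L\<^sup>2(T)\<close>\<close>

lift_definition vanishes_off :: "real set \<Rightarrow> L2 \<Rightarrow> bool"
  is "\<lambda>T f. AE t in lborel. t \<notin> T \<longrightarrow> f t = 0"
proof -
  fix T and f g assume "L2_eq f g"
  then have "AE t in lborel. f t = g t" by (simp add: L2_eq_def)
  then have "AE t in lborel. (t \<notin> T \<longrightarrow> f t = 0) = (t \<notin> T \<longrightarrow> g t = 0)"
    by eventually_elim simp
  then show "(AE t in lborel. t \<notin> T \<longrightarrow> f t = 0) = (AE t in lborel. t \<notin> T \<longrightarrow> g t = 0)"
    by (rule eventually_subst)
qed

definition L2_on :: "real set \<Rightarrow> L2 set" where
  "L2_on T = {f. vanishes_off T f}"

lemma L2_of_in_L2_on_iff: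
  assumes "sq_int f"
  shows "L2_of f \<in> L2_on T \<longleftrightarrow> (AE t in lborel. t \<notin> T \<longrightarrow> f t = 0)"
  unfolding L2_on_def mem_Collect_eq using assms by (transfer fixing: f) simp

lemma inner_L2_on:
  assumes "sq_int f" "sq_int g" "L2_of f \<in> L2_on T" "T \<in> sets borel"
  shows "inner (L2_of f) (L2_of g) = (LINT t:T|lborel. f t * g t)"
proof -
  note [measurable] = assms(1,2)[THEN sq_int_measurable] assms(4)
  have "AE t in lborel. t \<notin> T \<longrightarrow> f t = 0"
    using assms by (simp add: L2_of_in_L2_on_iff)
  then have "AE t in lborel. f t * g t = indicator T t *\<^sub>R (f t * g t)"
    by eventually_elim (auto simp: indicator_def)
  then have "(\<integral>t. f t * g t \<partial>lborel) = (\<integral>t. indicator T t *\<^sub>R (f t * g t) \<partial>lborel)"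
    by (intro integral_cong_AE) auto
  then show ?thesis
    using assms by (simp add: inner_L2_of set_lebesgue_integral_def)
qed

lemma L2_on_eq:
  assumes T: "T \<in> sets borel"
  shows "L2_on T = {f. \<forall>g. sq_int g \<and> (\<forall>t\<in>T. g t = 0) \<longrightarrow> inner f (L2_of g) = 0}"
proof (intro set_eqI iffI)
  fix F assume F: "F \<in> L2_on T"
  obtain f where f: "sq_int f" "F = L2_of f" by (rule L2_of_cases)
  have "inner F (L2_of g) = 0" if g: "sq_int g" "\<forall>t\<in>T. g t = 0" for g
  proof -
    have "inner F (L2_of g) = (LINT t:T|lborel. f t * g t)"
      using inner_L2_on[OF f(1) g(1) _ T] F f(2) by simp
    also have "\<dots> = (LINT t:T|lborel. 0)"
      using g(2) T by (intro set_lebesgue_integral_cong) auto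
    finally show ?thesis by (simp add: set_lebesgue_integral_def)
  qed
  then show "F \<in> {f. \<forall>g. sq_int g \<and> (\<forall>t\<in>T. g t = 0) \<longrightarrow> inner f (L2_of g) = 0}" by simp
next
  fix F assume F: "F \<in> {f. \<forall>g. sq_int g \<and> (\<forall>t\<in>T. g t = 0) \<longrightarrow> inner f (L2_of g) = 0}"
  obtain f where f: "sq_int f" "F = L2_of f" by (rule L2_of_cases)
  note [measurable] = sq_int_measurable[OF f(1)] T
  define g where "g t = indicator (- T) t * f t" for t
  have gm [measurable]: "g \<in> borel_measurable lborel" unfolding g_def by measurable
  have g: "sq_int g"
    by (rule sq_int_bound[OF gm sq_int_square[OF f(1)]]) (auto simp: g_def indicator_def)
  have "inner (L2_of g) (L2_of g) = inner F (L2_of g)"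
    using f g by (simp add: inner_L2_of) (auto intro!: Bochner_Integration.integral_cong simp: g_def indicator_def)
  also have "\<dots> = 0" using F g by (auto simp: g_def)
  finally have "L2_of g = L2_of (\<lambda>t. 0)" by (simp add: L2_of_zero)
  then have "AE t in lborel. g t = 0" using g sq_int_zero by (simp add: L2_of_eq_iff)
  then have "AE t in lborel. t \<notin> T \<longrightarrow> f t = 0"
    by eventually_elim (auto simp: g_def)
  then show "F \<in> L2_on T" using f by (simp add: L2_of_in_L2_on_iff)
qed

lemma subspace_L2_on: "T \<in> sets borel \<Longrightarrow> subspace (L2_on T)"
  by (auto simp: L2_on_eq subspace_def inner_add_left)

lemma closed_L2_on: "T \<in> sets borel \<Longrightarrow> closed (L2_on T)"
  unfolding L2_on_eq by (intro closed_Collect_all closed_Collect_imp closed_Collect_eq)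
    (auto intro!: continuous_intros)


section \<open>The functional linear model and least squares\<close>

definition law_support :: "'a::topological_space measure \<Rightarrow> 'a set" where
  "law_support P = {x. \<forall>U. open U \<longrightarrow> x \<in> U \<longrightarrow> emeasure P U > 0}"

definition closed_support_span :: "L2 measure \<Rightarrow> L2 set" where
  "closed_support_span P = (\<lambda>V. subspace V \<and> closed V) hull (law_support P)"

text \<open>For \<open>D \<subseteq> L2_on T\<close> it makes no difference whether the orthogonal complement is taken
  in \<open>L2_on T\<close> or, as here, in the whole of \<open>L2\<close>.\<close>

definition identifiable :: "L2 measure \<Rightarrow> L2 set \<Rightarrow> bool" where
  "identifiable P D \<longleftrightarrow> D \<inter> orthogonal_comp (closed_support_span P) = {0}"

locale functional_linear_model = prob_space N
  for N :: "'w measure"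
    and P :: "L2 measure"
    and \<sigma> :: real
    and x :: "nat \<Rightarrow> 'w \<Rightarrow> L2"
    and \<epsilon> :: "nat \<Rightarrow> 'w \<Rightarrow> real" +
  assumes design_indep: "indep_vars (\<lambda>_. borel) x UNIV"
    and design_law: "\<And>i. distr N borel (x i) = P"
    and noise_indep: "indep_vars (\<lambda>_. borel) \<epsilon> UNIV"
    and noise_square_integrable: "\<And>i. integrable N (\<lambda>\<omega>. (\<epsilon> i \<omega>)\<^sup>2)"
    and noise_mean: "\<And>i. expectation (\<epsilon> i) = 0"
    and noise_variance: "\<And>i. variance (\<epsilon> i) = \<sigma>\<^sup>2"
    and sigma_pos: "\<sigma> > 0"
    and design_noise_indep: "indep_set
      (sets (vimage_algebra (space N) (\<lambda>\<omega> i. x i \<omega>) (Pi\<^sub>M UNIV (\<lambda>_. borel))))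
      (sets (vimage_algebra (space N) (\<lambda>\<omega> i. \<epsilon> i \<omega>) (Pi\<^sub>M UNIV (\<lambda>_. borel))))"

text \<open>The model is consistent for every law \<open>P\<close> of the design and every \<open>\<sigma> > 0\<close>.\<close>

lemma functional_linear_model_exists:
  assumes P: "prob_space P" "sets P = sets borel" and \<sigma>: "\<sigma> > 0"
  shows "\<exists>(N :: ((nat \<Rightarrow> L2) \<times> (nat \<Rightarrow> real)) measure) x \<epsilon>. functional_linear_model N P \<sigma> x \<epsilon>"
proof -
  define Q :: "real measure" where "Q = density lborel (normal_density 0 \<sigma>)"
  define A where "A = Pi\<^sub>M (UNIV :: nat set) (\<lambda>_. P)"
  define B where "B = Pi\<^sub>M (UNIV :: nat set) (\<lambda>_. Q)"
  define N where "N = A \<Otimes>\<^sub>M B"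
  define x :: "nat \<Rightarrow> (nat \<Rightarrow> L2) \<times> (nat \<Rightarrow> real) \<Rightarrow> L2" where "x = (\<lambda>i \<omega>. fst \<omega> i)"
  define \<epsilon> :: "nat \<Rightarrow> (nat \<Rightarrow> L2) \<times> (nat \<Rightarrow> real) \<Rightarrow> real" where "\<epsilon> = (\<lambda>i \<omega>. snd \<omega> i)"
  have Q: "prob_space Q" "sets Q = sets borel"
    using \<sigma> by (simp_all add: Q_def prob_space_normal_density)
  interpret Q: prob_space Q by fact
  interpret A: prob_space A unfolding A_def by (rule prob_space_PiM) (rule P)
  interpret B: prob_space B unfolding B_def by (rule prob_space_PiM) (rule Q)
  interpret AB: pair_prob_space A B ..
  interpret N: prob_space N unfolding N_def by (rule AB.prob_space_axioms)
  have sA: "sets A = sets (Pi\<^sub>M UNIV (\<lambda>_. borel))" unfolding A_def using P(2) by (intro sets_PiM_cong) auto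
  have sB: "sets B = sets (Pi\<^sub>M UNIV (\<lambda>_. borel))" unfolding B_def using Q(2) by (intro sets_PiM_cong) auto
  have spA: "space A = UNIV" using sets_eq_imp_space_eq[OF sA] by (simp add: space_PiM)
  have spB: "space B = UNIV" using sets_eq_imp_space_eq[OF sB] by (simp add: space_PiM)
  have fm [measurable]: "fst \<in> N \<rightarrow>\<^sub>M A" and sm [measurable]: "snd \<in> N \<rightarrow>\<^sub>M B"
    unfolding N_def by measurable
  have dA: "distr N A fst = A" unfolding N_def by (rule B.distr_pair_fst)
  have dB: "distr N B snd = B"
    unfolding N_def
  proof (intro measure_eqI)
    fix S assume "S \<in> sets (distr (A \<Otimes>\<^sub>M B) B snd)"
    then have S: "S \<in> sets B" by simp
    have "emeasure (distr (A \<Otimes>\<^sub>M B) B snd) S = emeasure (A \<Otimes>\<^sub>M B) (space A \<times> S)"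
      using S by (subst emeasure_distr)
        (auto simp: space_pair_measure dest: sets.sets_into_space intro!: arg_cong2[where f=emeasure])
    also have "\<dots> = emeasure B S"
      using S by (simp add: B.emeasure_pair_measure_Times A.emeasure_space_1)
    finally show "emeasure (distr (A \<Otimes>\<^sub>M B) B snd) S = emeasure B S" .
  qed simp
  have cA [measurable]: "(\<lambda>a. a i) \<in> A \<rightarrow>\<^sub>M borel" for i
    unfolding measurable_cong_sets[OF sA refl] by (rule measurable_component_singleton) simp
  have cB [measurable]: "(\<lambda>b. b i) \<in> B \<rightarrow>\<^sub>M borel" for i
    unfolding measurable_cong_sets[OF sB refl] by (rule measurable_component_singleton) simp
  have xm [measurable]: "x i \<in> N \<rightarrow>\<^sub>M borel" for i unfolding x_def by measurable
  have em [measurable]: "\<epsilon> i \<in> N \<rightarrow>\<^sub>M borel" for i unfolding \<epsilon>_def by measurable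
  have lx: "distr N borel (x i) = P" for i
  proof -
    have "distr N borel (x i) = distr (distr N A fst) borel (\<lambda>a. a i)"
      by (subst distr_distr) (auto simp: x_def comp_def)
    also have "\<dots> = distr A P (\<lambda>a. a i)" unfolding dA by (rule distr_cong) (auto simp: P(2))
    also have "\<dots> = P" unfolding A_def using P(1) by (intro distr_PiM_component) auto
    finally show ?thesis .
  qed
  have le: "distr N borel (\<epsilon> i) = Q" for i
  proof -
    have "distr N borel (\<epsilon> i) = distr (distr N B snd) borel (\<lambda>a. a i)"
      by (subst distr_distr) (auto simp: \<epsilon>_def comp_def)
    also have "\<dots> = distr B Q (\<lambda>a. a i)" unfolding dB by (rule distr_cong) (auto simp: Q(2))
    also have "\<dots> = Q" unfolding B_def using Q(1) by (intro distr_PiM_component) auto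
    finally show ?thesis .
  qed
  have "distr N (Pi\<^sub>M UNIV (\<lambda>_. borel)) (\<lambda>\<omega>. \<lambda>i\<in>UNIV. x i \<omega>) = distr N A fst"
    by (rule distr_cong) (auto simp: x_def sA)
  then have ix: "N.indep_vars (\<lambda>_. borel) x UNIV"
    by (subst N.indep_vars_iff_distr_eq_PiM') (simp_all add: lx dA A_def[symmetric])
  have "distr N (Pi\<^sub>M UNIV (\<lambda>_. borel)) (\<lambda>\<omega>. \<lambda>i\<in>UNIV. \<epsilon> i \<omega>) = distr N B snd"
    by (rule distr_cong) (auto simp: \<epsilon>_def sB)
  then have ie: "N.indep_vars (\<lambda>_. borel) \<epsilon> UNIV"
    by (subst N.indep_vars_iff_distr_eq_PiM') (simp_all add: le dB B_def[symmetric])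
  have nd: "distributed N lborel (\<epsilon> i) (normal_density 0 \<sigma>)" for i
  proof -
    have "distr N lborel (\<epsilon> i) = distr N borel (\<epsilon> i)" by (rule distr_cong) auto
    then show ?thesis using le[of i] by (simp add: distributed_def Q_def)
  qed
  have int: "integrable N (\<lambda>\<omega>. (\<epsilon> i \<omega>)\<^sup>2)" for i
    using distributed_integrable[OF nd, of "\<lambda>t. t\<^sup>2" i] integrable_normal_moment[OF \<sigma>, of 0 2] by simp
  have "functional_linear_model N P \<sigma> x \<epsilon>"
  proof
    show "N.indep_set
      (sets (vimage_algebra (space N) (\<lambda>\<omega> i. x i \<omega>) (Pi\<^sub>M UNIV (\<lambda>_. borel))))
      (sets (vimage_algebra (space N) (\<lambda>\<omega> i. \<epsilon> i \<omega>) (Pi\<^sub>M UNIV (\<lambda>_. borel))))"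
      (is "N.indep_set ?a ?b")
    proof -
      have sp: "space N = UNIV" by (simp add: N_def space_pair_measure spA spB)
      have a: "?a = {S \<times> UNIV | S. S \<in> sets A}"
        by (subst sets_vimage_algebra2) (auto simp: sp sA x_def space_PiM set_eq_iff)
      have b: "?b = {UNIV \<times> S | S. S \<in> sets B}"
        by (subst sets_vimage_algebra2) (auto simp: sp sB \<epsilon>_def space_PiM set_eq_iff)
      have UA: "UNIV \<in> sets A" and UB: "UNIV \<in> sets B" using sets.top[of A] sets.top[of B] spA spB by auto
      have pr: "N.prob (S \<times> R) = A.prob S * B.prob R" if "S \<in> sets A" "R \<in> sets B" for S R
        using B.emeasure_pair_measure_Times[OF that]
        by (simp add: N_def measure_def enn2real_mult)
      have "N.indep_set {S \<times> UNIV | S. S \<in> sets A} {UNIV \<times> S | S. S \<in> sets B}"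
      proof (rule N.indep_setI, safe)
        show "S \<times> UNIV \<in> N.events" if "S \<in> sets A" for S using that UB by (simp add: N_def)
        show "UNIV \<times> S \<in> N.events" if "S \<in> sets B" for S using that UA by (simp add: N_def)
        show "N.prob (S \<times> UNIV \<inter> UNIV \<times> R) = N.prob (S \<times> UNIV) * N.prob (UNIV \<times> R)"
          if "S \<in> sets A" "R \<in> sets B" for S R
          using that pr UA UB A.prob_space B.prob_space spA spB by (simp add: Times_Int_Times)
      qed
      then show ?thesis unfolding a b .
    qed
  qed (use lx ix ie int \<sigma> nd N.normal_distributed_expectation[OF \<sigma> nd]
      N.normal_distributed_variance[OF \<sigma> nd] in auto)
  then show ?thesis by blast
qed

definition response :: "L2 \<Rightarrow> (nat \<Rightarrow> 'w \<Rightarrow> L2) \<Rightarrow> (nat \<Rightarrow> 'w \<Rightarrow> real) \<Rightarrow> nat \<Rightarrow> 'w \<Rightarrow> real" where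
  "response \<beta> x \<epsilon> i \<omega> = inner (x i \<omega>) \<beta> + \<epsilon> i \<omega>"

text \<open>When the minimiser is not unique, \<open>arg_min_on\<close> selects one of the minimisers.\<close>

definition least_squares ::
  "(nat \<Rightarrow> 'w \<Rightarrow> L2) \<Rightarrow> (nat \<Rightarrow> 'w \<Rightarrow> real) \<Rightarrow> L2 set \<Rightarrow> nat \<Rightarrow> 'w \<Rightarrow> L2" where
  "least_squares x y D n \<omega> = arg_min_on (\<lambda>b. \<Sum>i<n. (y i \<omega> - inner (x i \<omega>) b)\<^sup>2) D"

end

theory Submission
  imports Defs "HOL-Library.Discrete_Functions"
begin

text \<open>Let \<open>e\<^sub>0, e\<^sub>1, \<dots>\<close> be orthonormal in \<open>L\<^sup>2([0,1])\<close>. The differences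
  \<open>v\<^sub>j = e\<^sub>j - e\<^bsub>j+1\<^esub>\<close> are biorthogonal to the partial sums \<open>w\<^sub>k = e\<^sub>0 + \<dots> + e\<^sub>k\<close>, and
  \<open>\<langle>w\<^sub>k, e\<^sub>0\<rangle> = 1\<close> for all \<open>k\<close>. If the design takes only the values \<open>\<plusminus>2\<^bsup>-k\<^esup> w\<^sub>k\<close>, then the least
  squares problem on \<open>D\<^sub>d = span {v\<^sub>j. j < d}\<close> with \<open>\<beta> = e\<^sub>0\<close> decouples into \<open>d\<close> scalar ones, each
  with limiting coefficient \<open>1\<close>, so the limit estimator is \<open>v\<^sub>0 + \<dots> + v\<^bsub>d-1\<^esub> = e\<^sub>0 - e\<^sub>d\<close>. This is
  not a Cauchy sequence, but its Cesaro means converge to \<open>e\<^sub>0\<close>, which therefore lies in the closure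
  of \<open>\<Union>D\<^sub>d\<close>.\<close>

section \<open>Almost sure convergence from second moments\<close>

text \<open>By monotone convergence the series of the \<open>f n\<close> has finite integral, so it
  is finite almost everywhere and its terms vanish in the limit. In the strong law below this does
  the work of Borel-Cantelli.\<close>

lemma AE_tendsto_zero_of_summable_integrals:
  fixes f :: "nat \<Rightarrow> 'a \<Rightarrow> real"
  assumes int: "\<And>n. integrable M (f n)" and nonneg: "\<And>n \<omega>. 0 \<le> f n \<omega>"
    and sum: "summable (\<lambda>n. integral\<^sup>L M (f n))"
  shows "AE \<omega> in M. (\<lambda>n. f n \<omega>) \<longlonglongrightarrow> 0"
proof -
  note [measurable] = borel_measurable_integrable[OF int]
  have "(\<integral>\<^sup>+\<omega>. (\<Sum>n. ennreal (f n \<omega>)) \<partial>M) = (\<Sum>n. \<integral>\<^sup>+\<omega>. ennreal (f n \<omega>) \<partial>M)"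
    by (rule nn_integral_suminf) measurable
  also have "\<dots> = (\<Sum>n. ennreal (integral\<^sup>L M (f n)))"
    by (simp add: nn_integral_eq_integral int nonneg)
  also have "\<dots> = ennreal (\<Sum>n. integral\<^sup>L M (f n))"
    using sum by (intro suminf_ennreal2) (simp_all add: nonneg)
  finally have "(\<integral>\<^sup>+\<omega>. (\<Sum>n. ennreal (f n \<omega>)) \<partial>M) \<noteq> \<infinity>" by simp
  then have "AE \<omega> in M. (\<Sum>n. ennreal (f n \<omega>)) \<noteq> \<infinity>"
    by (intro nn_integral_PInf_AE) auto
  then show ?thesis
    by eventually_elim (auto intro!: summable_LIMSEQ_zero summable_suminf_not_top simp: nonneg)
qed

lemma integrable_mult_of_square_integrable:
  fixes f g :: "'a \<Rightarrow> real"
  assumes [measurable]: "f \<in> borel_measurable M" "g \<in> borel_measurable M"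
    and sq: "integrable M (\<lambda>\<omega>. (f \<omega>)\<^sup>2)" "integrable M (\<lambda>\<omega>. (g \<omega>)\<^sup>2)"
  shows "integrable M (\<lambda>\<omega>. f \<omega> * g \<omega>)"
proof (rule Bochner_Integration.integrable_bound)
  show "integrable M (\<lambda>\<omega>. (f \<omega>)\<^sup>2 + (g \<omega>)\<^sup>2)" using sq by simp
  have "\<bar>a * b\<bar> \<le> a\<^sup>2 + b\<^sup>2" for a b :: real
  proof -
    have "2 * \<bar>a * b\<bar> \<le> a\<^sup>2 + b\<^sup>2"
      using sum_squares_bound[of "\<bar>a\<bar>" "\<bar>b\<bar>"] by (simp add: abs_mult mult.assoc)
    moreover have "0 \<le> a\<^sup>2 + b\<^sup>2" by simp
    ultimately show ?thesis by linarith
  qed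
  then show "AE \<omega> in M. norm (f \<omega> * g \<omega>) \<le> norm ((f \<omega>)\<^sup>2 + (g \<omega>)\<^sup>2)" by simp
qed measurable

text \<open>Chebyshev's inequality along the squares; between consecutive squares \<open>n\<^sup>2\<close> and
  \<open>(n + 1)\<^sup>2\<close> the partial sums move by at most the absolute sum of \<open>2 n + 1\<close> terms, whose
  mean square is \<open>O(n\<^sup>2)\<close> by the Cauchy-Schwarz inequality alone.\<close>

lemma (in prob_space) strong_law_orthogonal:
  fixes Z :: "nat \<Rightarrow> 'a \<Rightarrow> real"
  assumes Z[measurable]: "\<And>i. random_variable borel (Z i)"
    and sq: "\<And>i. integrable M (\<lambda>\<omega>. (Z i \<omega>)\<^sup>2)"
    and bound: "\<And>i. expectation (\<lambda>\<omega>. (Z i \<omega>)\<^sup>2) \<le> C"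
    and orth: "\<And>i j. i \<noteq> j \<Longrightarrow> expectation (\<lambda>\<omega>. Z i \<omega> * Z j \<omega>) = 0"
  shows "AE \<omega> in M. (\<lambda>n. (\<Sum>i<n. Z i \<omega>) / n) \<longlonglongrightarrow> 0"
proof -
  have prod: "integrable M (\<lambda>\<omega>. Z i \<omega> * Z j \<omega>)" for i j
    by (intro integrable_mult_of_square_integrable sq) measurable
  have C: "C \<ge> 0" using bound[of 0] by (rule order_trans[rotated]) simp
  define S where "S n \<omega> = (\<Sum>i<n\<^sup>2. Z i \<omega>)" for n \<omega>
  define R where "R n \<omega> = (\<Sum>i\<in>{n\<^sup>2..<(Suc n)\<^sup>2}. \<bar>Z i \<omega>\<bar>)" for n \<omega>
  have S2: "(S n \<omega>)\<^sup>2 = (\<Sum>i<n\<^sup>2. \<Sum>j<n\<^sup>2. Z i \<omega> * Z j \<omega>)" for n \<omega>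
    by (simp add: S_def power2_eq_square[of "sum _ _"] sum_product)
  have intS: "integrable M (\<lambda>\<omega>. (S n \<omega>)\<^sup>2)" for n
    unfolding S2 by (intro Bochner_Integration.integrable_sum prod)
  have ES: "expectation (\<lambda>\<omega>. (S n \<omega>)\<^sup>2) \<le> real (n\<^sup>2) * C" for n
  proof -
    have "expectation (\<lambda>\<omega>. (S n \<omega>)\<^sup>2) = (\<Sum>i<n\<^sup>2. \<Sum>j<n\<^sup>2. expectation (\<lambda>\<omega>. Z i \<omega> * Z j \<omega>))"
      unfolding S2 by (simp add: prod)
    also have "\<dots> = (\<Sum>i<n\<^sup>2. \<Sum>j<n\<^sup>2. if i = j then expectation (\<lambda>\<omega>. (Z i \<omega>)\<^sup>2) else 0)"
      using orth by (intro sum.cong refl) (simp add: power2_eq_square)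
    also have "\<dots> = (\<Sum>i<n\<^sup>2. expectation (\<lambda>\<omega>. (Z i \<omega>)\<^sup>2))" by (simp add: sum.delta)
    also have "\<dots> \<le> (\<Sum>i<n\<^sup>2. C)" by (intro sum_mono bound)
    finally show ?thesis by simp
  qed
  have card: "card {n\<^sup>2..<(Suc n)\<^sup>2} = 2 * n + 1" for n :: nat
    by (simp add: power2_eq_square)
  have R2: "(R n \<omega>)\<^sup>2 \<le> (\<Sum>i\<in>{n\<^sup>2..<(Suc n)\<^sup>2}. (Z i \<omega>)\<^sup>2) * (2 * n + 1)" for n \<omega>
    using sum_squared_le_sum_of_squares[of "\<lambda>i. \<bar>Z i \<omega>\<bar>" "{n\<^sup>2..<(Suc n)\<^sup>2}"]
    unfolding R_def card by simp
  have intR': "integrable M (\<lambda>\<omega>. (\<Sum>i\<in>{n\<^sup>2..<(Suc n)\<^sup>2}. (Z i \<omega>)\<^sup>2) * (2 * n + 1))" for n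
    by (intro integrable_mult_left Bochner_Integration.integrable_sum sq)
  have Rm[measurable]: "random_variable borel (R n)" and Sm[measurable]: "random_variable borel (S n)" for n
    unfolding R_def S_def by measurable
  have intR: "integrable M (\<lambda>\<omega>. (R n \<omega>)\<^sup>2)" for n
    by (rule Bochner_Integration.integrable_bound[OF intR'])
      (use R2 in \<open>auto intro: order_trans[OF _ abs_ge_self]\<close>)
  have ER: "expectation (\<lambda>\<omega>. (R n \<omega>)\<^sup>2) \<le> (2 * real n + 1)\<^sup>2 * C" for n
  proof -
    have "expectation (\<lambda>\<omega>. (R n \<omega>)\<^sup>2)
        \<le> expectation (\<lambda>\<omega>. (\<Sum>i\<in>{n\<^sup>2..<(Suc n)\<^sup>2}. (Z i \<omega>)\<^sup>2) * (2 * n + 1))"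
      by (intro integral_mono intR intR' R2)
    also have "\<dots> = (\<Sum>i\<in>{n\<^sup>2..<(Suc n)\<^sup>2}. expectation (\<lambda>\<omega>. (Z i \<omega>)\<^sup>2)) * (2 * n + 1)"
      by (simp add: sq)
    also have "\<dots> \<le> (\<Sum>i\<in>{n\<^sup>2..<(Suc n)\<^sup>2}. C) * (2 * n + 1)"
      by (intro mult_right_mono sum_mono bound) simp
    also have "\<dots> = (2 * real n + 1)\<^sup>2 * C" unfolding sum_constant card by (simp add: power2_eq_square algebra_simps)
    finally show ?thesis .
  qed
  \<comment> \<open>The denominator is the square of the sample size \<open>n^2\<close>. Both second
    moments are O(\<open>n^2\<close>), so \<open>U n\<close> has mean O(1/\<open>n^2\<close>), and
    one summable series controls the sums at the squares and the fluctuations between them.\<close>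
  define U where "U n \<omega> = ((S n \<omega>)\<^sup>2 + (R n \<omega>)\<^sup>2) / n ^ 4" for n \<omega>
  \<comment> \<open>The shift to \<open>Suc n\<close> keeps the denominator positive. With m \<ge> 1
    we have 2m + 1 \<le> 3m, whence the constant 10 = 1 + 9.\<close>
  have EU: "expectation (U (Suc n)) \<le> 10 * C * inverse ((Suc n)\<^sup>2)" for n
  proof -
    define m where "m = real (Suc n)"
    have m: "m \<ge> 1" by (simp add: m_def)
    have "expectation (U (Suc n))
        = (expectation (\<lambda>\<omega>. (S (Suc n) \<omega>)\<^sup>2) + expectation (\<lambda>\<omega>. (R (Suc n) \<omega>)\<^sup>2)) / m ^ 4"
      unfolding U_def m_def by (simp add: intS intR)
    also have "\<dots> \<le> (m\<^sup>2 * C + (2 * m + 1)\<^sup>2 * C) / m ^ 4"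
      using ES[of "Suc n"] ER[of "Suc n"] unfolding m_def
      by (intro divide_right_mono add_mono) (simp_all del: of_nat_Suc)
    also have "\<dots> = (m\<^sup>2 + (2 * m + 1)\<^sup>2) * C / m ^ 4" by (simp add: algebra_simps)
    also have "\<dots> \<le> (10 * m\<^sup>2) * C / m ^ 4"
    proof (intro divide_right_mono mult_right_mono C)
      have "(2 * m + 1)\<^sup>2 \<le> (3 * m)\<^sup>2" using m by (intro power_mono) auto
      then show "m\<^sup>2 + (2 * m + 1)\<^sup>2 \<le> 10 * m\<^sup>2" by (simp add: power_mult_distrib)
    qed simp
    also have "\<dots> = 10 * C * inverse (m\<^sup>2)" using m by (simp add: field_simps power2_eq_square power4_eq_xxxx)
    finally show ?thesis by (simp add: m_def)
  qed
  have "AE \<omega> in M. (\<lambda>n. U (Suc n) \<omega>) \<longlonglongrightarrow> 0"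
  proof (rule AE_tendsto_zero_of_summable_integrals)
    show "integrable M (U (Suc n))" for n unfolding U_def by (simp add: intS intR)
    show "0 \<le> U (Suc n) \<omega>" for n \<omega> by (simp add: U_def)
    have "summable (\<lambda>n. inverse ((real (Suc n))\<^sup>2))"
      using inverse_power_summable[of 2, where 'a = real] by (subst summable_Suc_iff) simp
    then have "summable (\<lambda>n. 10 * C * inverse (real ((Suc n)\<^sup>2)))" by (intro summable_mult) simp
    then show "summable (\<lambda>n. expectation (U (Suc n)))"
      by (rule summable_comparison_test'[where N = 0])
        (use EU in \<open>simp add: U_def integral_nonneg_AE\<close>)
  qed
  then show ?thesis
  proof eventually_elim
    case (elim \<omega>)
    have U: "(\<lambda>n. U n \<omega>) \<longlonglongrightarrow> 0" using elim by (rule LIMSEQ_imp_Suc)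
    \<comment> \<open>For an arbitrary sample size m the relevant index is the n with
      \<open>n^2 \<le> m < (n + 1)^2\<close>, that is \<open>floor_sqrt m\<close>. It tends to
      infinity, so \<open>U\<close> also vanishes along it.\<close>
    have "filterlim floor_sqrt at_top sequentially"
      unfolding filterlim_at_top eventually_sequentially
    proof
      fix k show "\<exists>N. \<forall>n\<ge>N. k \<le> floor_sqrt n"
        by (rule exI[of _ "k\<^sup>2"]) (simp add: le_floor_sqrt_iff)
    qed
    from filterlim_compose[OF U this]
    have "(\<lambda>n. sqrt (2 * U (floor_sqrt n) \<omega>)) \<longlonglongrightarrow> sqrt (2 * 0)" by (intro tendsto_intros)
    then have lim: "(\<lambda>n. sqrt (2 * U (floor_sqrt n) \<omega>)) \<longlonglongrightarrow> 0" by simp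
    show ?case
    proof (rule Lim_null_comparison[OF _ lim], use eventually_gt_at_top[of 0] in eventually_elim)
      case (elim m)
      define n where "n = floor_sqrt m"
      have n: "n > 0" "n\<^sup>2 \<le> m" "m < (Suc n)\<^sup>2"
        using elim Suc_floor_sqrt_power2_gt[of m] by (auto simp: n_def)
      have "(\<Sum>i<m. Z i \<omega>) = S n \<omega> + (\<Sum>i\<in>{n\<^sup>2..<m}. Z i \<omega>)"
        using sum.atLeastLessThan_concat[OF _ n(2), of 0 "\<lambda>i. Z i \<omega>"] by (simp add: S_def lessThan_atLeast0)
      also have "\<bar>\<dots>\<bar> \<le> \<bar>S n \<omega>\<bar> + (\<Sum>i\<in>{n\<^sup>2..<m}. \<bar>Z i \<omega>\<bar>)"
        by (intro order_trans[OF abs_triangle_ineq] add_left_mono sum_abs)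
      also have "\<dots> \<le> \<bar>S n \<omega>\<bar> + R n \<omega>"
        unfolding R_def using n by (intro add_left_mono sum_mono2) auto
      finally have "\<bar>\<Sum>i<m. Z i \<omega>\<bar> / m \<le> (\<bar>S n \<omega>\<bar> + R n \<omega>) / real (n\<^sup>2)"
        using n by (intro frac_le) (auto simp flip: of_nat_power)
      \<comment> \<open>This is \<open>(a + b)^2 \<le> 2 (a^2 + b^2)\<close>, divided by
        \<open>n^4 = (n^2)^2\<close>.\<close>
      also have "\<dots> \<le> sqrt (2 * U n \<omega>)"
      proof (rule real_le_rsqrt)
        have "(\<bar>S n \<omega>\<bar> + R n \<omega>)\<^sup>2 \<le> 2 * ((S n \<omega>)\<^sup>2 + (R n \<omega>)\<^sup>2)"
          using sum_squares_bound[of "\<bar>S n \<omega>\<bar>" "R n \<omega>"] by (simp add: power2_sum)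
        then show "((\<bar>S n \<omega>\<bar> + R n \<omega>) / real (n\<^sup>2))\<^sup>2 \<le> 2 * U n \<omega>"
          using n by (simp add: U_def power_divide divide_right_mono flip: power_mult)
      qed
      finally show ?case by (simp add: n_def)
    qed
  qed
qed

section \<open>Deterministic least squares\<close>

text \<open>The normal equations remove the cross term, so passing from \<open>b\<close> to
  \<open>c\<close> raises the objective by exactly the sum of the squares of
  \<open>inner (x i \<omega>) (c - b)\<close>. Injectivity makes this increase strict for
  \<open>c\<close> other than \<open>b\<close>.\<close>

lemma least_squares_eqI:
  assumes D: "subspace D" and b: "b \<in> D"
    and normal_eq: "\<And>z. z \<in> D \<Longrightarrow> (\<Sum>i<n. (y i \<omega> - inner (x i \<omega>) b) * inner (x i \<omega>) z) = 0"
    and inj: "\<And>z. z \<in> D \<Longrightarrow> (\<And>i. i < n \<Longrightarrow> inner (x i \<omega>) z = 0) \<Longrightarrow> z = 0"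
  shows "least_squares x y D n \<omega> = b"
proof -
  define Q where "Q b = (\<Sum>i<n. (y i \<omega> - inner (x i \<omega>) b)\<^sup>2)" for b
  have Q: "Q c = Q b + (\<Sum>i<n. (inner (x i \<omega>) (c - b))\<^sup>2)" if "c \<in> D" for c
  proof -
    have "Q c = (\<Sum>i<n. (y i \<omega> - inner (x i \<omega>) b)\<^sup>2 + (inner (x i \<omega>) (c - b))\<^sup>2
        - 2 * ((y i \<omega> - inner (x i \<omega>) b) * inner (x i \<omega>) (c - b)))"
      unfolding Q_def by (intro sum.cong refl) (simp add: inner_diff_right power2_eq_square algebra_simps)
    also have "\<dots> = Q b + (\<Sum>i<n. (inner (x i \<omega>) (c - b))\<^sup>2)"
      using normal_eq[OF subspace_diff[OF D \<open>c \<in> D\<close> b]]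
      by (simp add: sum_subtractf sum.distrib Q_def flip: sum_distrib_left)
    finally show ?thesis .
  qed
  have le: "Q b \<le> Q c" if "c \<in> D" for c
    unfolding Q[OF that] by (simp add: sum_nonneg)
  have uniq: "c = b" if c: "c \<in> D" "Q c \<le> Q b" for c
  proof -
    have "(\<Sum>i<n. (inner (x i \<omega>) (c - b))\<^sup>2) \<le> 0" using Q[OF c(1)] c(2) by simp
    moreover have "(\<Sum>i<n. (inner (x i \<omega>) (c - b))\<^sup>2) \<ge> 0" by (intro sum_nonneg) simp
    ultimately have "(\<Sum>i<n. (inner (x i \<omega>) (c - b))\<^sup>2) = 0" by simp
    then have "\<And>i. i < n \<Longrightarrow> inner (x i \<omega>) (c - b) = 0"
      by (subst (asm) sum_nonneg_eq_0_iff) auto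
    from inj[OF subspace_diff[OF D c(1) b] this] show "c = b" by simp
  qed
  \<comment> \<open>\<open>arg_min_on\<close> is a choice operator: it is known to return a
    minimiser only once some minimiser, here \<open>b\<close>, has been exhibited. Uniqueness then
    identifies the chosen one.\<close>
  have "is_arg_min Q (\<lambda>x. x \<in> D) b" using b le by (auto simp: is_arg_min_def not_less)
  then have "is_arg_min Q (\<lambda>x. x \<in> D) (arg_min_on Q D)"
    unfolding arg_min_on_def arg_min_def by (rule someI)
  then have "arg_min_on Q D = b" by (intro uniq) (use b in \<open>auto simp: is_arg_min_def not_less\<close>)
  then show ?thesis by (simp add: least_squares_def Q_def[abs_def])
qed

text \<open>Indexing the coefficients by \<open>I\<close> instead of by vectors lets biorthogonality
  be read off index by index.\<close>

lemma span_image_finite: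
  fixes v :: "'i \<Rightarrow> 'a::real_vector"
  assumes "finite I"
  shows "span (v ` I) = range (\<lambda>c. \<Sum>i\<in>I. c i *\<^sub>R v i)"
proof
  show "span (v ` I) \<subseteq> range (\<lambda>c. \<Sum>i\<in>I. c i *\<^sub>R v i)"
  proof (rule span_minimal)
    show "v ` I \<subseteq> range (\<lambda>c. \<Sum>i\<in>I. c i *\<^sub>R v i)"
    proof
      fix z assume "z \<in> v ` I"
      then obtain k where k: "k \<in> I" "z = v k" by auto
      have "z = (\<Sum>i\<in>I. if i = k then v i else 0)" using k assms by simp
      also have "\<dots> = (\<Sum>i\<in>I. (if i = k then 1 else 0) *\<^sub>R v i)" by (intro sum.cong) auto
      finally show "z \<in> range (\<lambda>c. \<Sum>i\<in>I. c i *\<^sub>R v i)"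
        by (rule range_eqI[of _ _ "\<lambda>i. if i = k then 1 else 0"])
    qed
    show "subspace (range (\<lambda>c. \<Sum>i\<in>I. c i *\<^sub>R v i))"
      unfolding subspace_def
    proof safe
      show "0 \<in> range (\<lambda>c. \<Sum>i\<in>I. c i *\<^sub>R v i)" by (rule range_eqI[of _ _ "\<lambda>_. 0"]) simp
      show "(\<Sum>i\<in>I. a i *\<^sub>R v i) + (\<Sum>i\<in>I. c i *\<^sub>R v i) \<in> range (\<lambda>c. \<Sum>i\<in>I. c i *\<^sub>R v i)" for a c
        by (rule range_eqI[of _ _ "\<lambda>i. a i + c i"]) (simp add: scaleR_add_left sum.distrib)
      show "r *\<^sub>R (\<Sum>i\<in>I. a i *\<^sub>R v i) \<in> range (\<lambda>c. \<Sum>i\<in>I. c i *\<^sub>R v i)" for r a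
        by (rule range_eqI[of _ _ "\<lambda>i. r * a i"]) (simp add: scaleR_sum_right)
    qed
  qed
  show "range (\<lambda>c. \<Sum>i\<in>I. c i *\<^sub>R v i) \<subseteq> span (v ` I)"
    by (auto intro: span_sum span_scale span_base)
qed

section \<open>Laws of large numbers for the design and the noise\<close>

context functional_linear_model
begin

lemma design_measurable [measurable]: "random_variable borel (x i)"
  using design_indep by (simp add: indep_vars_def)

lemma noise_measurable [measurable]: "random_variable borel (\<epsilon> i)"
  using noise_indep by (simp add: indep_vars_def)

text \<open>The model states independence for the sigma-algebras generated by the two whole
  sequences. A measurable function of a sequence generates a smaller sigma-algebra, so independence
  is inherited.\<close>

lemma design_noise_functions_indep:
  fixes f :: "(nat \<Rightarrow> L2) \<Rightarrow> real" and g :: "(nat \<Rightarrow> real) \<Rightarrow> real"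
  assumes f: "f \<in> borel_measurable (Pi\<^sub>M UNIV (\<lambda>_. borel))"
    and g: "g \<in> borel_measurable (Pi\<^sub>M UNIV (\<lambda>_. borel))"
  shows "indep_var borel (\<lambda>\<omega>. f (\<lambda>i. x i \<omega>)) borel (\<lambda>\<omega>. g (\<lambda>i. \<epsilon> i \<omega>))"
proof -
  have sub: "sigma_sets (space N) {(\<lambda>\<omega>. h (Y \<omega>)) -` A \<inter> space N | A. A \<in> sets borel}
      \<subseteq> sets (vimage_algebra (space N) Y S)"
    if "h \<in> borel_measurable S" "Y \<in> N \<rightarrow>\<^sub>M S" for h :: "'z \<Rightarrow> real" and Y :: "'w \<Rightarrow> 'z" and S
  proof -
    have "(\<lambda>\<omega>. h (Y \<omega>)) \<in> vimage_algebra (space N) Y S \<rightarrow>\<^sub>M borel"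
      by (rule measurable_compose[OF measurable_vimage_algebra1 that(1)])
        (use measurable_space[OF that(2)] in auto)
    from measurable_sets[OF this]
    have "{(\<lambda>\<omega>. h (Y \<omega>)) -` A \<inter> space N | A. A \<in> sets borel} \<subseteq> sets (vimage_algebra (space N) Y S)"
      by auto
    then show ?thesis
      by (intro sets.sigma_sets_subset[of _ "vimage_algebra (space N) Y S", simplified])
  qed
  have m: "(\<lambda>\<omega> i. x i \<omega>) \<in> N \<rightarrow>\<^sub>M Pi\<^sub>M UNIV (\<lambda>_. borel)" "(\<lambda>\<omega> i. \<epsilon> i \<omega>) \<in> N \<rightarrow>\<^sub>M Pi\<^sub>M UNIV (\<lambda>_. borel)"
    by (rule measurable_PiM_single'; simp)+
  have "indep_set (sigma_sets (space N) {(\<lambda>\<omega>. f (\<lambda>i. x i \<omega>)) -` A \<inter> space N | A. A \<in> sets borel})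
      (sigma_sets (space N) {(\<lambda>\<omega>. g (\<lambda>i. \<epsilon> i \<omega>)) -` A \<inter> space N | A. A \<in> sets borel})"
    unfolding indep_set_def
    by (rule indep_sets_mono_sets[OF design_noise_indep[unfolded indep_set_def]])
      (use sub[OF f m(1)] sub[OF g m(2)] in \<open>auto split: bool.splits\<close>)
  then show ?thesis
    unfolding indep_var_eq using measurable_compose[OF m(1) f] measurable_compose[OF m(2) g] by simp
qed

text \<open>All design points share the law \<open>P\<close> and there are countably many of them,
  so a single null set serves for every index.\<close>

lemma AE_design:
  assumes Q: "{z. Q z} \<in> sets borel" and "AE z in P. Q z"
  shows "AE \<omega> in N. \<forall>i. Q (x i \<omega>)"
  unfolding AE_all_countable
proof
  fix i
  have "AE z in distr N borel (x i). Q z" unfolding design_law by (rule assms(2))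
  then show "AE \<omega> in N. Q (x i \<omega>)" using Q by (subst (asm) AE_distr_iff) auto
qed

lemma integrable_design_iff:
  fixes f :: "L2 \<Rightarrow> real"
  assumes "f \<in> borel_measurable borel"
  shows "integrable N (\<lambda>\<omega>. f (x i \<omega>)) \<longleftrightarrow> integrable P f"
  using integrable_distr_eq[OF design_measurable assms, of i] by (simp add: design_law)

lemma expectation_design:
  fixes f :: "L2 \<Rightarrow> real"
  assumes "f \<in> borel_measurable borel"
  shows "expectation (\<lambda>\<omega>. f (x i \<omega>)) = integral\<^sup>L P f"
  using integral_distr[OF design_measurable assms, of i] by (simp add: design_law)

text \<open>After centring, independence makes the variables \<open>f (x i)\<close> pairwise
  orthogonal with a common second moment, which puts them in the scope of
  \<open>strong_law_orthogonal\<close>.\<close>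

lemma strong_law_design:
  fixes f :: "L2 \<Rightarrow> real"
  assumes f [measurable]: "f \<in> borel_measurable borel"
    and int: "integrable P f" and sq: "integrable P (\<lambda>z. (f z)\<^sup>2)"
  shows "AE \<omega> in N. (\<lambda>n. (\<Sum>i<n. f (x i \<omega>)) / n) \<longlonglongrightarrow> integral\<^sup>L P f"
proof -
  define m where "m = integral\<^sup>L P f"
  define g where "g z = f z - m" for z
  have g[measurable]: "g \<in> borel_measurable borel" unfolding g_def by measurable
  have fN: "integrable N (\<lambda>\<omega>. f (x i \<omega>))" for i
    using int by (simp add: integrable_design_iff)
  have "integrable N (\<lambda>\<omega>. (f (x i \<omega>))\<^sup>2 - 2 * m * f (x i \<omega>) + m\<^sup>2)" for i
    using sq by (intro Bochner_Integration.integrable_add Bochner_Integration.integrable_diff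
      integrable_mult_right fN) (simp_all add: integrable_design_iff[of "\<lambda>z. (f z)\<^sup>2"])
  then have gsq: "integrable N (\<lambda>\<omega>. (g (x i \<omega>))\<^sup>2)" for i
    by (simp add: g_def power2_diff algebra_simps)
  have gN: "integrable N (\<lambda>\<omega>. g (x i \<omega>))" and g0: "expectation (\<lambda>\<omega>. g (x i \<omega>)) = 0" for i
    using fN by (simp_all add: g_def expectation_design m_def prob_space)
  have "AE \<omega> in N. (\<lambda>n. (\<Sum>i<n. g (x i \<omega>)) / n) \<longlonglongrightarrow> 0"
  proof (rule strong_law_orthogonal[OF _ gsq])
    show "expectation (\<lambda>\<omega>. (g (x i \<omega>))\<^sup>2) \<le> integral\<^sup>L P (\<lambda>z. (g z)\<^sup>2)" for i
      by (simp add: expectation_design[of "\<lambda>z. (g z)\<^sup>2"])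
    fix i j :: nat assume "i \<noteq> j"
    have "indep_vars (\<lambda>_. borel) (\<lambda>i \<omega>. g (x i \<omega>)) UNIV"
      using indep_vars_compose2[OF design_indep, of "\<lambda>_. g" "\<lambda>_. borel"] by simp
    then have "indep_vars (\<lambda>_. borel) (\<lambda>i \<omega>. g (x i \<omega>)) {i, j}"
      by (rule indep_vars_subset) simp
    from indep_vars_lebesgue_integral[OF _ this gN]
    show "expectation (\<lambda>\<omega>. g (x i \<omega>) * g (x j \<omega>)) = 0"
      using \<open>i \<noteq> j\<close> by (simp add: g0)
  qed measurable
  then show ?thesis
  proof eventually_elim
    case (elim \<omega>)
    have "(\<lambda>n. (\<Sum>i<n. g (x i \<omega>)) / n + m) \<longlonglongrightarrow> 0 + m" by (intro tendsto_intros elim)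
    moreover have "\<forall>\<^sub>F n in sequentially. (\<Sum>i<n. g (x i \<omega>)) / n + m = (\<Sum>i<n. f (x i \<omega>)) / n"
      using eventually_gt_at_top[of 0] by eventually_elim (simp add: g_def sum_subtractf field_simps)
    ultimately show ?case
      unfolding m_def[symmetric] by (auto dest: Lim_transform_eventually)
  qed
qed

text \<open>Independence of design and noise factors the mixed moments into a design part and a
  noise part. For distinct indices the noise part is a product of zero means, so the summands are
  orthogonal.\<close>

lemma strong_law_noise:
  fixes g :: "L2 \<Rightarrow> real"
  assumes g [measurable]: "g \<in> borel_measurable borel" and sq: "integrable P (\<lambda>z. (g z)\<^sup>2)"
  shows "AE \<omega> in N. (\<lambda>n. (\<Sum>i<n. \<epsilon> i \<omega> * g (x i \<omega>)) / n) \<longlonglongrightarrow> 0"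
proof -
  have sqN: "integrable N (\<lambda>\<omega>. (g (x i \<omega>))\<^sup>2)" for i
    using sq by (simp add: integrable_design_iff[of "\<lambda>z. (g z)\<^sup>2"])
  have gg: "integrable N (\<lambda>\<omega>. g (x i \<omega>) * g (x j \<omega>))" for i j
    by (intro integrable_mult_of_square_integrable sqN) measurable
  have ee: "integrable N (\<lambda>\<omega>. \<epsilon> i \<omega> * \<epsilon> j \<omega>)" for i j
    by (intro integrable_mult_of_square_integrable noise_square_integrable) measurable
  have e1: "integrable N (\<epsilon> i)" for i
    using integrable_mult_of_square_integrable[of "\<epsilon> i" N "\<lambda>_. 1"] noise_square_integrable by simp
  have ind: "indep_var borel (\<lambda>\<omega>. g (x i \<omega>) * g (x j \<omega>)) borel (\<lambda>\<omega>. \<epsilon> i \<omega> * \<epsilon> j \<omega>)" for i j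
    by (rule design_noise_functions_indep[of "\<lambda>z. g (z i) * g (z j)" "\<lambda>e. e i * e j"]) measurable
  note E = indep_var_lebesgue_integral[OF ind gg ee] indep_var_integrable[OF ind gg ee]
  \<comment> \<open>Collecting the design factors on the left and the noise factors on the right
    gives the shape required by \<open>E\<close>; the case i = j covers the second moments.\<close>
  have swap: "\<epsilon> i \<omega> * g (x i \<omega>) * (\<epsilon> j \<omega> * g (x j \<omega>)) = g (x i \<omega>) * g (x j \<omega>) * (\<epsilon> i \<omega> * \<epsilon> j \<omega>)"
    for i j \<omega> by simp
  have var: "expectation (\<lambda>\<omega>. (\<epsilon> i \<omega>)\<^sup>2) = \<sigma>\<^sup>2" for i
    using noise_variance[of i] by (simp add: noise_mean)
  show ?thesis
  proof (rule strong_law_orthogonal)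
    show "integrable N (\<lambda>\<omega>. (\<epsilon> i \<omega> * g (x i \<omega>))\<^sup>2)" for i
      unfolding power2_eq_square swap by (rule E(2))
    show "expectation (\<lambda>\<omega>. (\<epsilon> i \<omega> * g (x i \<omega>))\<^sup>2) \<le> integral\<^sup>L P (\<lambda>z. (g z)\<^sup>2) * \<sigma>\<^sup>2" for i
      using E(1)[of i i] expectation_design[of "\<lambda>z. (g z)\<^sup>2" i] var[of i]
      unfolding power2_eq_square swap by simp
    fix i j :: nat assume "i \<noteq> j"
    have "indep_vars (\<lambda>_. borel) \<epsilon> {i, j}" using noise_indep by (rule indep_vars_subset) simp
    from indep_vars_lebesgue_integral[OF _ this e1]
    have "expectation (\<lambda>\<omega>. \<epsilon> i \<omega> * \<epsilon> j \<omega>) = 0" using \<open>i \<noteq> j\<close> by (simp add: noise_mean)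
    then show "expectation (\<lambda>\<omega>. \<epsilon> i \<omega> * g (x i \<omega>) * (\<epsilon> j \<omega> * g (x j \<omega>))) = 0"
      unfolding swap E(1) by simp
  qed measurable
qed

text \<open>When every design point is orthogonal to all but one of the \<open>v j\<close>, the least squares
  problem splits into one-dimensional ones and the estimator has an explicit formula.\<close>

lemma least_squares_biorthogonal_tendsto:
  fixes v :: "nat \<Rightarrow> L2"
  assumes diag: "AE z in P. \<forall>i j. i \<noteq> j \<longrightarrow> inner z (v i) * inner z (v j) = 0"
    and \<beta>: "AE z in P. \<forall>j. inner z \<beta> * inner z (v j) = (inner z (v j))\<^sup>2"
    and int: "\<And>j. integrable P (\<lambda>z. (inner z (v j))\<^sup>2)" "\<And>j. integrable P (\<lambda>z. (inner z (v j)) ^ 4)"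
    and pos: "\<And>j. integral\<^sup>L P (\<lambda>z. (inner z (v j))\<^sup>2) > 0"
  shows "AE \<omega> in N. (\<lambda>n. least_squares x (response \<beta> x \<epsilon>) (span (v ` {..<d})) n \<omega>) \<longlonglongrightarrow> (\<Sum>j<d. v j)"
proof -
  have A1: "AE \<omega> in N. \<forall>k. (\<forall>i j. i \<noteq> j \<longrightarrow> inner (x k \<omega>) (v i) * inner (x k \<omega>) (v j) = 0)"
    by (rule AE_design[OF _ diag]) measurable
  have A2: "AE \<omega> in N. \<forall>k. (\<forall>j. inner (x k \<omega>) \<beta> * inner (x k \<omega>) (v j) = (inner (x k \<omega>) (v j))\<^sup>2)"
    by (rule AE_design[OF _ \<beta>]) measurable
  \<comment> \<open>The strong law is applied to the squares of \<open>inner z (v j)\<close>; their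
    second moments are the assumed fourth moments.\<close>
  have A3: "AE \<omega> in N. \<forall>j. (\<lambda>n. (\<Sum>i<n. (inner (x i \<omega>) (v j))\<^sup>2) / n) \<longlonglongrightarrow> integral\<^sup>L P (\<lambda>z. (inner z (v j))\<^sup>2)"
    unfolding AE_all_countable
    by (intro allI strong_law_design int) (use int in \<open>simp_all flip: power_mult\<close>)
  have A4: "AE \<omega> in N. \<forall>j. (\<lambda>n. (\<Sum>i<n. \<epsilon> i \<omega> * inner (x i \<omega>) (v j)) / n) \<longlonglongrightarrow> 0"
    unfolding AE_all_countable by (intro allI strong_law_noise int) measurable
  show ?thesis using A1 A2 A3 A4
  proof eventually_elim
    case (elim \<omega>)
    define B where "B n j = (\<Sum>i<n. (inner (x i \<omega>) (v j))\<^sup>2)" for n j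
    define A where "A n j = (\<Sum>i<n. \<epsilon> i \<omega> * inner (x i \<omega>) (v j))" for n j
    \<comment> \<open>The empirical Gram matrix of the \<open>v j\<close> is diagonal with entries
      \<open>B n j\<close>, so the normal equations are solved coordinate by coordinate. The signal
      contributes \<open>B n j\<close> by the hypothesis on \<open>\<beta>\<close> and the noise
      contributes \<open>A n j\<close>; their sum over \<open>B n j\<close> is the
      coefficient.\<close>
    define b where "b n = (\<Sum>j<d. (1 + A n j / B n j) *\<^sub>R v j)" for n
    have lim: "(\<lambda>n. 1 + A n j / B n j) \<longlonglongrightarrow> 1" for j
    proof -
      have "(\<lambda>n. 1 + (A n j / n) / (B n j / n)) \<longlonglongrightarrow> 1 + 0 / integral\<^sup>L P (\<lambda>z. (inner z (v j))\<^sup>2)"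
        using elim(3,4) pos[of j] unfolding A_def B_def by (intro tendsto_intros) auto
      moreover have "\<forall>\<^sub>F n in sequentially. 1 + (A n j / n) / (B n j / n) = 1 + A n j / B n j"
        using eventually_gt_at_top[of 0] by eventually_elim simp
      ultimately show ?thesis using Lim_transform_eventually by fastforce
    qed
    have "b \<longlonglongrightarrow> (\<Sum>j<d. 1 *\<^sub>R v j)"
      unfolding b_def by (intro tendsto_intros lim)
    moreover have "\<forall>\<^sub>F n in sequentially. b n = least_squares x (response \<beta> x \<epsilon>) (span (v ` {..<d})) n \<omega>"
    proof -
      \<comment> \<open>\<open>B n j / n\<close> has a positive limit, so for large n all of the
        finitely many \<open>B n j\<close> are nonzero. Only then are the quotients in
        \<open>b n\<close> genuine and the minimiser unique.\<close>
      have "\<forall>\<^sub>F n in sequentially. \<forall>j\<in>{..<d}. B n j / n > 0"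
        using elim(3) pos unfolding B_def by (intro eventually_ball_finite ballI order_tendstoD(1)) auto
      then show ?thesis
      proof eventually_elim
        case (elim n)
        then have B: "B n j \<noteq> 0" if "j < d" for j
          using bspec[OF elim(1), of j] that by (cases "B n j = 0") simp_all
        note diag = \<open>\<forall>k i j. i \<noteq> j \<longrightarrow> inner (x k \<omega>) (v i) * inner (x k \<omega>) (v j) = 0\<close>
        note hb = \<open>\<forall>k j. inner (x k \<omega>) \<beta> * inner (x k \<omega>) (v j) = (inner (x k \<omega>) (v j))\<^sup>2\<close>
        \<comment> \<open>Multiplying by \<open>inner (x k \<omega>) (v j)\<close> annihilates every
          term of the combination except the one at \<open>j\<close>.\<close>
        have comb: "inner (x k \<omega>) (\<Sum>j<d. c j *\<^sub>R v j) * inner (x k \<omega>) (v j) = c j * (inner (x k \<omega>) (v j))\<^sup>2"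
          if "j < d" for c k j
        proof -
          have "inner (x k \<omega>) (\<Sum>j<d. c j *\<^sub>R v j) * inner (x k \<omega>) (v j)
              = (\<Sum>i<d. c i * (inner (x k \<omega>) (v i) * inner (x k \<omega>) (v j)))"
            by (simp add: inner_sum_right sum_distrib_right mult.assoc)
          also have "\<dots> = (\<Sum>i<d. if i = j then c j * (inner (x k \<omega>) (v j))\<^sup>2 else 0)"
            using diag by (intro sum.cong) (auto simp: power2_eq_square)
          finally show ?thesis using that by simp
        qed
        have sp: "\<exists>c. z = (\<Sum>j<d. c j *\<^sub>R v j)" if "z \<in> span (v ` {..<d})" for z
          using that by (auto simp: span_image_finite)
        show ?case
        proof (rule least_squares_eqI[symmetric])
          show "b n \<in> span (v ` {..<d})"
            unfolding b_def by (intro span_sum span_scale span_base) auto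
          show "(\<Sum>i<n. (response \<beta> x \<epsilon> i \<omega> - inner (x i \<omega>) (b n)) * inner (x i \<omega>) z) = 0"
            if z: "z \<in> span (v ` {..<d})" for z
          proof -
            have v: "(\<Sum>i<n. (response \<beta> x \<epsilon> i \<omega> - inner (x i \<omega>) (b n)) * inner (x i \<omega>) (v j)) = 0"
              if j: "j < d" for j
            proof -
              have "(\<Sum>i<n. (response \<beta> x \<epsilon> i \<omega> - inner (x i \<omega>) (b n)) * inner (x i \<omega>) (v j))
                  = (\<Sum>i<n. (inner (x i \<omega>) (v j))\<^sup>2 + \<epsilon> i \<omega> * inner (x i \<omega>) (v j)
                      - (1 + A n j / B n j) * (inner (x i \<omega>) (v j))\<^sup>2)"
                unfolding b_def response_def left_diff_distrib comb[OF j] distrib_right hb[rule_format] by simp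
              also have "\<dots> = B n j + A n j - (1 + A n j / B n j) * B n j"
                unfolding A_def B_def by (simp only: sum_subtractf sum.distrib sum_distrib_left)
              also have "\<dots> = 0" using B[OF j] by (simp add: field_simps)
              finally show ?thesis .
            qed
            obtain c where "z = (\<Sum>j<d. c j *\<^sub>R v j)" using sp[OF z] by blast
            then have "(\<Sum>i<n. (response \<beta> x \<epsilon> i \<omega> - inner (x i \<omega>) (b n)) * inner (x i \<omega>) z)
                = (\<Sum>i<n. \<Sum>j<d. c j * ((response \<beta> x \<epsilon> i \<omega> - inner (x i \<omega>) (b n)) * inner (x i \<omega>) (v j)))"
              by (simp add: inner_sum_right sum_distrib_left mult.assoc mult.left_commute)
            also have "\<dots> = (\<Sum>j<d. c j * (\<Sum>i<n. (response \<beta> x \<epsilon> i \<omega> - inner (x i \<omega>) (b n)) * inner (x i \<omega>) (v j)))"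
              by (subst sum.swap) (simp add: sum_distrib_left)
            finally show ?thesis by (simp add: v)
          qed
          show "z = 0" if z: "z \<in> span (v ` {..<d})" "\<And>i. i < n \<Longrightarrow> inner (x i \<omega>) z = 0" for z
          proof -
            obtain c where c: "z = (\<Sum>j<d. c j *\<^sub>R v j)" using sp[OF z(1)] by blast
            have "c j = 0" if j: "j < d" for j
            proof -
              \<comment> \<open>Pairing the vanishing values \<open>inner (x i \<omega>) z\<close>
                with those of \<open>v j\<close> isolates the coefficient
                \<open>c j\<close>.\<close>
              have "c j * B n j = (\<Sum>i<n. inner (x i \<omega>) z * inner (x i \<omega>) (v j))"
                unfolding c comb[OF j] B_def by (simp add: sum_distrib_left)
              also have "\<dots> = 0" using z(2) by simp
              finally show ?thesis using B[OF j] by simp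
            qed
            then show ?thesis unfolding c by simp
          qed
        qed (rule subspace_span)
      qed
    qed
    ultimately show ?case by (auto dest: Lim_transform_eventually)
  qed
qed

end

section \<open>Orthonormal vectors and a symmetric discrete design\<close>

text \<open>Normalised indicators of disjoint dyadic intervals are used. The interval
  \<open>I i\<close> has length \<open>(1/2) ^ Suc i\<close>, hence the factor
  \<open>sqrt (2 ^ Suc i)\<close>.\<close>

lemma orthonormal_sequence_L2_on:
  obtains e :: "nat \<Rightarrow> L2" where
    "\<And>i. e i \<in> L2_on {0..1}" "\<And>i j. inner (e i) (e j) = (if i = j then 1 else 0)"
proof -
  define I where "I i = {(1/2) ^ Suc i<..(1/2 :: real) ^ i}" for i
  define f where "f i t = sqrt (2 ^ Suc i) * indicator (I i) t" for i t
  have [measurable]: "I i \<in> sets borel" for i by (simp add: I_def)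
  have fm [measurable]: "f i \<in> borel_measurable borel" for i unfolding f_def by measurable
  have ff: "f i t * f i t = 2 ^ Suc i * indicator (I i) t" for i t
    by (simp add: f_def indicator_def)
  have int: "has_bochner_integral lborel (\<lambda>t. f i t * f i t) 1" for i
  proof -
    have "has_bochner_integral lborel (\<lambda>t. 2 ^ Suc i * indicator (I i) t) (2 ^ Suc i * measure lborel (I i))"
      by (intro has_bochner_integral_mult_right has_bochner_integral_real_indicator) (auto simp: I_def)
    also have "2 ^ Suc i * measure lborel (I i) = 1"
      by (simp add: I_def field_simps power_one_over)
    finally show ?thesis unfolding ff .
  qed
  have disj: "f i t * f j t = 0" if "i \<noteq> j" for i j t
  proof -
    \<comment> \<open>For i < j the interval \<open>I j\<close> ends no further right than the left
      endpoint of \<open>I i\<close>, which is excluded from \<open>I i\<close>.\<close>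
    have "t \<notin> I i \<or> t \<notin> I j" if "i < j" for i j
    proof (rule ccontr)
      assume "\<not> ?thesis"
      then have "(1/2) ^ Suc i < t" "t \<le> (1/2) ^ j" by (auto simp: I_def)
      moreover have "(1/2 :: real) ^ j \<le> (1/2) ^ Suc i"
        using \<open>i < j\<close> by (intro power_decreasing) auto
      ultimately show False by simp
    qed
    then show ?thesis using that by (metis (no_types, lifting) f_def indicator_simps(2) linorder_neqE_nat mult_zero_left mult_zero_right)
  qed
  have sq: "sq_int (f i)" for i
    using int[of i] by (simp add: sq_int_def power2_eq_square has_bochner_integral_iff)
  show thesis
  proof
    show "L2_of (f i) \<in> L2_on {0..1}" for i
      unfolding L2_of_in_L2_on_iff[OF sq]
    proof (intro always_eventually allI impI)
      fix t :: real assume t: "t \<notin> {0..1}"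
      have "0 < (1/2 :: real) ^ Suc i" "(1/2 :: real) ^ i \<le> 1" by (auto intro: power_le_one)
      then have "t \<notin> I i" using t unfolding I_def atLeastAtMost_iff greaterThanAtMost_iff by linarith
      then show "f i t = 0" by (simp add: f_def)
    qed
    show "inner (L2_of (f i)) (L2_of (f j)) = (if i = j then 1 else 0)" for i j
      using int[of i] disj[of i j] unfolding inner_L2_of[OF sq sq]
      by (cases "i = j") (simp_all only: has_bochner_integral_iff if_True if_False
        Bochner_Integration.integral_zero refl not_False_eq_True)
  qed
qed

text \<open>A geometric index gives every \<open>u k\<close> positive mass, and an independent fair
  sign makes the law invariant under negation, which forces mean zero.\<close>

lemma symmetric_discrete_random_element:
  fixes u :: "nat \<Rightarrow> 'a::{banach, second_countable_topology}"
  obtains p :: "real pmf" and X :: "real \<Rightarrow> 'a" where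
    "\<And>s. X s \<in> range u \<union> uminus ` range u" "integral\<^sup>L (measure_pmf p) X = 0"
    "\<And>k. \<exists>s\<in>set_pmf p. X s = u k"
proof -
  define q where "q = pair_pmf (geometric_pmf (1/2)) (bernoulli_pmf (1/2))"
  define Y where "Y = (\<lambda>(k, b). if b then u k else - u k)"
  \<comment> \<open>The pairs of index and sign are encoded as reals to obtain a sample space of the
    required type. \<open>X\<close> decodes through the floor, so it takes values among the
    \<plusminus>\<open>u k\<close> on the whole line and not only on the atoms.\<close>
  define g :: "nat \<times> bool \<Rightarrow> real" where "g = (\<lambda>kb. real (to_nat kb))"
  define X where "X s = Y (from_nat (nat \<lfloor>s\<rfloor>))" for s :: real
  have Xg: "X (g kb) = Y kb" for kb by (simp add: X_def g_def)
  \<comment> \<open>Flipping the fair coin preserves \<open>q\<close> and negates \<open>Y\<close>,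
    so the integral of \<open>Y\<close> equals its own negative.\<close>
  have "map_pmf Not (bernoulli_pmf (1/2)) = bernoulli_pmf (1/2)"
    by (simp add: bernoulli_pmf_half_conv_pmf_of_set map_pmf_of_set_inj inj_on_def UNIV_bool insert_commute)
  then have "map_pmf (apsnd Not) q = q"
    by (simp add: q_def flip: pair_map_pmf2)
  then have "integral\<^sup>L (measure_pmf q) Y = integral\<^sup>L (measure_pmf (map_pmf (apsnd Not) q)) Y"
    by simp
  also have "\<dots> = integral\<^sup>L (measure_pmf q) (\<lambda>kb. - Y kb)"
    unfolding integral_map_pmf
    by (intro Bochner_Integration.integral_cong refl) (auto simp: Y_def split: prod.split)
  also have "\<dots> = - integral\<^sup>L (measure_pmf q) Y" by simp
  finally have "2 *\<^sub>R integral\<^sup>L (measure_pmf q) Y = 0"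
    unfolding scaleR_2 eq_neg_iff_add_eq_0 .
  then have Y0: "integral\<^sup>L (measure_pmf q) Y = 0" by simp
  show thesis
  proof
    show "X s \<in> range u \<union> uminus ` range u" for s by (auto simp: X_def Y_def split: prod.split)
    show "integral\<^sup>L (measure_pmf (map_pmf g q)) X = 0" by (simp add: Xg Y0)
    show "\<exists>s\<in>set_pmf (map_pmf g q). X s = u k" for k
      by (rule bexI[of _ "g (k, True)"]) (auto simp: Xg Y_def q_def set_pmf_geometric)
  qed
qed

text \<open>Every neighbourhood of the image of an atom carries at least the mass of that atom. This
  places all \<open>u k\<close> in the support, which is what identifiability rests on.\<close>

lemma pmf_support_in_law_support:
  fixes X :: "'a \<Rightarrow> 'b::topological_space"
  assumes "s \<in> set_pmf p"
  shows "X s \<in> law_support (distr (measure_pmf p) borel X)"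
  unfolding law_support_def
proof safe
  fix U assume U: "open U" "X s \<in> U"
  have "measure (measure_pmf p) (X -` U) \<noteq> 0"
    using assms U by (auto simp: measure_pmf_zero_iff)
  then show "emeasure (distr (measure_pmf p) borel X) U > 0"
    using U by (subst emeasure_distr) (auto simp: measure_pmf.emeasure_eq_measure zero_less_measure_iff)
qed

section \<open>The diverging limits and the verification of the model\<close>

theorem mainTheorem4:
  shows "\<exists>(T :: real set) (M :: real measure) (X :: real \<Rightarrow> L2) (D :: nat \<Rightarrow> L2 set)
      (\<beta> :: L2) (limit :: nat \<Rightarrow> L2).
    compact T \<and>
    prob_space M \<and> X \<in> borel_measurable M \<and> (\<forall>s\<in>space M. X s \<in> L2_on T) \<and>
    integrable M (\<lambda>s. (norm (X s))\<^sup>2) \<and> integrable M X \<and> integral\<^sup>L M X = 0 \<and>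
    (\<forall>d\<ge>1. subspace (D d) \<and> D d \<subseteq> L2_on T \<and> dim (D d) = d \<and>
       identifiable (distr M borel X) (D d) \<and> D d \<subseteq> D (Suc d)) \<and>
    \<beta> \<in> closure (\<Union>d\<in>{1..}. D d) \<and>
    (\<forall>d\<ge>1. limit d \<in> L2_on T) \<and>
    (\<forall>\<sigma> (N :: 'w measure) x \<epsilon>. functional_linear_model N (distr M borel X) \<sigma> x \<epsilon> \<longrightarrow>
       (\<forall>d\<ge>1. AE \<omega> in N. (\<lambda>n. least_squares x (response \<beta> x \<epsilon>) (D d) n \<omega>) \<longlonglongrightarrow> limit d)) \<and>
    \<not> (\<exists>l\<in>L2_on T. limit \<longlonglongrightarrow> l)"
proof -
  obtain e :: "nat \<Rightarrow> L2" where eT: "\<And>i. e i \<in> L2_on {0..1}"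
    and ee: "\<And>i j. inner (e i) (e j) = (if i = j then 1 else 0)"
    by (rule orthonormal_sequence_L2_on) blast
  define w where "w k = (\<Sum>i\<le>k. e i)" for k
  define v where "v j = e j - e (Suc j)" for j
  \<comment> \<open>The norms of the \<open>w k\<close> are unbounded; the damping factor makes the
    design bounded, so all its moments are finite. Being nonzero, it preserves the biorthogonality
    relations up to scaling.\<close>
  define u where "u k = (1/2) ^ k *\<^sub>R w k" for k
  define D where "D d = span (v ` {..<d})" for d
  define limit where "limit d = (\<Sum>j<d. v j)" for d
  obtain p :: "real pmf" and X where
    Xu: "\<And>s. X s \<in> range u \<union> uminus ` range u" and X0: "integral\<^sup>L (measure_pmf p) X = 0"
    and uX: "\<And>k. \<exists>s\<in>set_pmf p. X s = u k"
    by (rule symmetric_discrete_random_element[of u]) blast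
  define P where "P = distr (measure_pmf p) borel X"
  have T: "subspace (L2_on {0..1})" by (rule subspace_L2_on) simp
  have norm_e: "norm (e i) = 1" for i by (simp add: norm_eq_sqrt_inner ee)
  have we: "inner (w k) (e j) = (if j \<le> k then 1 else 0)" for k j
    by (simp add: w_def inner_sum_left ee)
  have wv: "inner (w k) (v j) = (if k = j then 1 else 0)" for k j
    by (auto simp: v_def inner_diff_right we)
  have vT: "v j \<in> L2_on {0..1}" for j unfolding v_def by (intro subspace_diff[OF T] eT)
  have limit_eq: "limit d = e 0 - e d" for d
    unfolding limit_def v_def using sum_lessThan_telescope[of "\<lambda>j. - e j" d] by simp
  have bnd: "norm (u k) \<le> 1" for k
  proof -
    have "norm (w k) \<le> (\<Sum>i\<le>k. norm (e i))" unfolding w_def by (rule norm_sum)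
    also have "\<dots> = real (Suc k)" by (simp add: norm_e)
    \<comment> \<open>The crude bound k + 1 \<le> \<open>2 ^ k\<close> is why the weights
      \<open>(1/2) ^ k\<close> suffice.\<close>
    also have "\<dots> \<le> real (2 ^ k)" by (subst of_nat_le_iff) (simp add: Suc_le_eq)
    finally show ?thesis by (simp add: u_def power_one_over field_simps)
  qed
  have Xbnd: "norm (X s) \<le> 1" for s using Xu[of s] bnd by auto
  have XT: "X s \<in> L2_on {0..1}" for s
  proof -
    have "u k \<in> L2_on {0..1}" for k
      unfolding u_def w_def by (intro subspace_scale[OF T] subspace_sum[OF T] eT)
    then show ?thesis using Xu[of s] subspace_neg[OF T] by auto
  qed
  \<comment> \<open>Sign and weight are absorbed into one scalar \<open>c\<close>: the identities
    required of the design are homogeneous of degree two, so they need checking only on the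
    \<open>w k\<close>.\<close>
  have Xform: "\<exists>k c. X s = c *\<^sub>R w k" for s
  proof -
    have "X s = ((1/2) ^ k) *\<^sub>R w k \<or> X s = (- ((1/2) ^ k)) *\<^sub>R w k" if "X s = u k \<or> X s = - u k" for k
      using that by (auto simp: u_def)
    then show ?thesis using Xu[of s] by blast
  qed
  have Xm: "X \<in> borel_measurable (measure_pmf p)" by simp

  have ident: "identifiable P (D d)" for d
    unfolding identifiable_def
  proof (intro equalityI subsetI)
    fix b assume "b \<in> D d \<inter> orthogonal_comp (closed_support_span P)"
    then have b: "b \<in> D d" "\<And>z. z \<in> closed_support_span P \<Longrightarrow> inner z b = 0"
      by (auto simp: orthogonal_comp_def orthogonal_def)
    obtain c where c: "b = (\<Sum>j<d. c j *\<^sub>R v j)"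
      using b(1) by (auto simp: D_def span_image_finite)
    have "c k = 0" if "k < d" for k
    proof -
      obtain s where s: "s \<in> set_pmf p" "X s = u k" using uX by blast
      \<comment> \<open>Orthogonality to the support point \<open>u k\<close> reads off the
        coefficient of \<open>v k\<close> in \<open>b\<close>, because \<open>w k\<close> is dual to
        \<open>v k\<close>.\<close>
      have "u k \<in> law_support P"
        using pmf_support_in_law_support[OF s(1), of X] by (simp add: P_def s(2))
      then have "inner (u k) b = 0"
        by (intro b(2)) (auto simp: closed_support_span_def intro: hull_inc)
      then have "inner (w k) b = 0" by (simp add: u_def)
      moreover have "inner (w k) b = c k" using that by (simp add: c inner_sum_right wv if_distrib cong: if_cong)
      ultimately show ?thesis by simp
    qed
    then show "b \<in> {0}" by (simp add: c)
  next
    fix b :: L2 assume "b \<in> {0}"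
    then show "b \<in> D d \<inter> orthogonal_comp (closed_support_span P)"
      by (auto simp: D_def span_zero orthogonal_comp_def orthogonal_def)
  qed

  have dim: "dim (D d) = d" for d
  proof -
    have inj: "inj_on v {..<d}" by (rule inj_onI) (metis wv zero_neq_one)
    have "independent (v ` {..<d})"
      unfolding dependent_def
    proof safe
      fix k assume k: "v k \<in> span (v ` {..<d} - {v k})"
      \<comment> \<open>The kernel of the functional given by \<open>w k\<close> contains all the
        other \<open>v i\<close> but not \<open>v k\<close>.\<close>
      have "span (v ` {..<d} - {v k}) \<subseteq> {z. inner (w k) z = 0}"
        by (rule span_minimal) (auto simp: wv subspace_def inner_add_right)
      then show False using k wv[of k k] by auto
    qed
    then have "dim (D d) = card (v ` {..<d})" unfolding D_def by (rule dim_span_eq_card_independent)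
    then show ?thesis using inj by (simp add: card_image)
  qed

  have closure: "e 0 \<in> closure (\<Union>d\<in>{1..}. D d)"
  proof -
    \<comment> \<open>The average runs from \<open>limit 1\<close> to \<open>limit (Suc m)\<close>,
      so it lies in \<open>D (Suc m)\<close>. Its distance from \<open>e 0\<close> is the norm of
      the mean of m + 1 orthonormal vectors, which is 1 / sqrt (m + 1).\<close>
    define b where "b m = (1 / real (Suc m)) *\<^sub>R (\<Sum>i\<le>m. limit (Suc i))" for m
    have "b m \<in> (\<Union>d\<in>{1..}. D d)" for m
    proof
      show "b m \<in> D (Suc m)"
        unfolding b_def D_def limit_def
        by (intro span_scale span_sum span_base) auto
    qed simp
    moreover have "b \<longlonglongrightarrow> e 0"
    proof -
      have diff: "b m - e 0 = - ((1 / real (Suc m)) *\<^sub>R (\<Sum>i\<le>m. e (Suc i)))" for m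
        by (simp add: b_def limit_eq sum_subtractf scaleR_diff_right sum_constant_scaleR)
      have "(norm (\<Sum>i\<le>m. e (Suc i)))\<^sup>2 = real (Suc m)" for m
        by (simp add: power2_norm_eq_inner inner_sum_left inner_sum_right ee)
      then have "norm (\<Sum>i\<le>m. e (Suc i)) = sqrt (real (Suc m))" for m
        by (metis norm_ge_zero real_sqrt_unique)
      then have "norm (b m - e 0) = 1 / sqrt (real (Suc m))" for m
        unfolding diff by (simp add: real_div_sqrt field_simps)
      moreover have "(\<lambda>m. 1 / sqrt (real (Suc m))) \<longlonglongrightarrow> 0"
        by real_asymp
      ultimately have "(\<lambda>m. norm (b m - e 0)) \<longlonglongrightarrow> 0" by simp
      then show ?thesis by (simp only: tendsto_norm_zero_iff LIM_zero_iff)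
    qed
    ultimately show ?thesis unfolding closure_sequential by blast
  qed

  have lsq: "AE \<omega> in N. (\<lambda>n. least_squares x (response (e 0) x \<epsilon>) (D d) n \<omega>) \<longlonglongrightarrow> limit d"
    if "functional_linear_model N P \<sigma> x \<epsilon>" for N :: "'w measure" and \<sigma> x \<epsilon> d
  proof -
    interpret functional_linear_model N P \<sigma> x \<epsilon> by fact
    have vb: "\<bar>inner (X s) (v j)\<bar> \<le> norm (v j)" for s j
      using Cauchy_Schwarz_ineq2[of "X s" "v j"] mult_right_mono[OF Xbnd, of "norm (v j)" s] by simp
    have int: "integrable P (\<lambda>z. (inner z (v j)) ^ n)" for j n
      unfolding P_def
    proof (subst integrable_distr_eq)
      show "integrable (measure_pmf p) (\<lambda>s. (inner (X s) (v j)) ^ n)"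
        by (rule measure_pmf.integrable_const_bound[of _ "norm (v j) ^ n"])
          (auto simp: power_abs intro!: AE_pmfI power_mono vb)
    qed simp_all
    show ?thesis
      unfolding D_def limit_def
    proof (rule least_squares_biorthogonal_tendsto)
      show "AE z in P. \<forall>i j. i \<noteq> j \<longrightarrow> inner z (v i) * inner z (v j) = 0"
        unfolding P_def
      proof (subst AE_distr_iff)
        have "inner (X s) (v i) * inner (X s) (v j) = 0" if "i \<noteq> j" for s i j
          using Xform[of s] that by (auto simp: wv)
        then show "AE s in measure_pmf p. \<forall>i j. i \<noteq> j \<longrightarrow> inner (X s) (v i) * inner (X s) (v j) = 0"
          by simp
      qed (simp, measurable)
      show "AE z in P. \<forall>j. inner z (e 0) * inner z (v j) = (inner z (v j))\<^sup>2"
        unfolding P_def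
      proof (subst AE_distr_iff)
        \<comment> \<open>On a multiple \<open>c *\<^sub>R w k\<close> both sides are
          \<open>c^2\<close> if j = k and 0 otherwise, because \<open>w k\<close> has inner product
          1 with \<open>e 0\<close> and with \<open>v k\<close>. Thus each scalar regression sees
          the coefficient 1.\<close>
        have "inner (X s) (e 0) * inner (X s) (v j) = (inner (X s) (v j))\<^sup>2" for s j
          using Xform[of s] by (auto simp: wv we power2_eq_square)
        then show "AE s in measure_pmf p. \<forall>j. inner (X s) (e 0) * inner (X s) (v j) = (inner (X s) (v j))\<^sup>2"
          by simp
      qed (simp, measurable)
      show "integral\<^sup>L P (\<lambda>z. (inner z (v j))\<^sup>2) > 0" for j
      proof (rule ccontr)
        assume "\<not> ?thesis"
        then have "integral\<^sup>L P (\<lambda>z. (inner z (v j))\<^sup>2) = 0"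
          by (intro antisym) (auto intro: integral_nonneg_AE)
        then have "AE z in P. (inner z (v j))\<^sup>2 = 0"
          using integral_nonneg_eq_0_iff_AE[OF int[of j 2]] by simp
        then have "AE s in measure_pmf p. (inner (X s) (v j))\<^sup>2 = 0"
          unfolding P_def by (subst (asm) AE_distr_iff) simp_all
        \<comment> \<open>The atom at \<open>u j\<close> refutes almost sure vanishing: its inner
          product with \<open>v j\<close> is \<open>(1/2) ^ j\<close>.\<close>
        moreover obtain s where s: "s \<in> set_pmf p" "X s = u j" using uX by blast
        ultimately have "inner (u j) (v j) = 0" by (auto simp: AE_measure_pmf_iff)
        then show False by (simp add: u_def wv)
      qed
    qed (rule int)+
  qed

  have noconv: "\<not> limit \<longlonglongrightarrow> l" for l
  proof
    assume l: "limit \<longlonglongrightarrow> l"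
    have "(\<lambda>d. (norm (limit (Suc d) - limit d))\<^sup>2) \<longlonglongrightarrow> (norm (l - l))\<^sup>2"
      by (intro tendsto_intros l LIMSEQ_Suc)
    \<comment> \<open>Consecutive limits differ by \<open>v d\<close>, a difference of two
      orthonormal vectors, so their distance stays at sqrt 2.\<close>
    moreover have "(norm (limit (Suc d) - limit d))\<^sup>2 = 2" for d
      by (simp add: limit_def power2_norm_eq_inner v_def inner_diff_left inner_diff_right ee)
    ultimately show False by (simp add: LIMSEQ_const_iff)
  qed

  have DT: "D d \<subseteq> L2_on {0..1}" for d
    unfolding D_def by (rule span_minimal[OF _ T]) (use vT in auto)
  have mono: "D d \<subseteq> D (Suc d)" for d
    unfolding D_def by (rule span_mono) auto
  have sub: "subspace (D d)" for d
    unfolding D_def by (rule subspace_span)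
  have limit_T: "limit d \<in> L2_on {0..1}" for d
    unfolding limit_def by (intro subspace_sum[OF T] vT)
  have intX: "integrable (measure_pmf p) X" "integrable (measure_pmf p) (\<lambda>s. (norm (X s))\<^sup>2)"
    by (rule measure_pmf.integrable_const_bound[of _ 1]; simp add: Xbnd power_le_one)+
  show ?thesis
  proof (intro exI conjI allI impI ballI)
    show "compact {0..1 :: real}" by simp
    show "X \<in> borel_measurable (measure_pmf p)" by (rule Xm)
    show "identifiable (distr (measure_pmf p) borel X) (D d)" for d using ident by (simp add: P_def)
    show "AE \<omega> in N. (\<lambda>n. least_squares x (response (e 0) x \<epsilon>) (D d) n \<omega>) \<longlonglongrightarrow> limit d"
      if "functional_linear_model N (distr (measure_pmf p) borel X) \<sigma> x \<epsilon>"
      for N :: "'w measure" and \<sigma> x \<epsilon> d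
      using lsq that by (simp add: P_def)
    show "\<not> (\<exists>l\<in>L2_on {0..1}. limit \<longlonglongrightarrow> l)" using noconv by blast
  qed (rule XT X0 dim closure DT mono sub limit_T intX measure_pmf.prob_space_axioms)+
qed

end
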